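(* Let $\Psi=(\Delta,\Gamma)$ be a $(d-1)$-dimensional Cohen–Macaulay relative complex and $\Psi'=(\Delta',\Gamma')$ a Cohen–Macaulay full relative subcomplex of codimension one (i.e. of dimension $d-2$). Then $h_k(\Psi,\Psi')\ge h_{k-1}(\Psi')$ for all $k$.
   Context: Work over an infinite field. A relative complex $(\Delta,\Gamma)$ is a pair of simplicial complexes with $\Gamma\subsetneq\Delta$; it is Cohen–Macaulay if its face module $I_\Gamma/I_\Delta$ (with $I_\Delta$ the Stanley–Reisner ideal) has depth equal to its Krull dimension. A relative subcomplex of $\Psi$ is a relative complex $\Psi'=(\Delta',\Gamma')$ with $\Delta'\subseteq\Delta$, $\Gamma'\subseteq\Gamma$; it is full if $\Delta'$ is a full subcomplex of $\Delta$ (every face of $\Delta$ with all vertices in $\Delta'$ lies in $\Delta'$). The pair $(\Psi,\Psi')$ denotes the relative complex $(\Delta,\Gamma\cup\Delta')$. For a relative complex of dimension $D-1$ with $f_i$ the number of $i$-faces of the larger complex not in the smaller one, $\sum_{k=0}^Df_{k-1}t^k(1-t)^{D-k}=\sum_kh_kt^k$ defines the $h$-vector; $h(\Psi,\Psi')$ is taken with $D=d$ and $h(\Psi')$ with $D=d-1$.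
   Formalization: The formal theorem also assumes that every face of Ψ' is a face of Ψ, i.e. Γ' = Γ ∩ Δ'; with only Γ' ⊆ Γ the claim fails, e.g. for Δ an edge ab, Γ its boundary, Δ' = {∅,{a}}, Γ' void, where h_1(Ψ,Ψ') = 0 < 1 = h_0(Ψ'). *)

theory Defs
  imports
    Main
    "HOL-Library.Extended_Nat"
    "HOL-Library.Poly_Mapping"
    "HOL-Computational_Algebra.Polynomial"
begin

section \<open>Depth and Krull dimension of a subquotient\<close>

text \<open>
  A commutative ring is a module over itself through multiplication; its ideals are the
  submodules in the sense of \<^theory>\<open>HOL.Modules\<close>. For ideals \<open>L \<subseteq> N\<close>, the notions below are those
  of the module \<open>N / L\<close>, written out on representatives. In particular
  \<open>(N / L) / a (N / L) = N / (L + a N)\<close>.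
\<close>

definition ring_ideal :: "'a::comm_ring_1 set \<Rightarrow> bool" where
  "ring_ideal I \<longleftrightarrow> module.subspace (*) I"

definition ideal_gen :: "'a::comm_ring_1 set \<Rightarrow> 'a set" where
  "ideal_gen B = module.span (*) B"

definition prime_ideal :: "'a::comm_ring_1 set \<Rightarrow> bool" where
  "prime_ideal P \<longleftrightarrow>
     ring_ideal P \<and> P \<noteq> UNIV \<and> (\<forall>a b. a * b \<in> P \<longrightarrow> a \<in> P \<or> b \<in> P)"

definition annihilator :: "'a::comm_ring_1 set \<Rightarrow> 'a set \<Rightarrow> 'a set" where
  "annihilator N L = {r. \<forall>x\<in>N. r * x \<in> L}"

text \<open>
  The dimension of \<open>N / L\<close> is the Krull dimension of the ring modulo the annihilator. (The supremum
  of the empty set is \<open>0\<close> in \<^typ>\<open>enat\<close>, so the value is meaningful only if \<open>N / L\<close> is nonzero;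
  this is the case for face modules of relative complexes.)
\<close>

definition krull_dim :: "'a::comm_ring_1 set \<Rightarrow> 'a set \<Rightarrow> enat" where
  "krull_dim N L = Sup {enat n | n. \<exists>P :: nat \<Rightarrow> 'a set.
     (\<forall>i\<le>n. prime_ideal (P i) \<and> annihilator N L \<subseteq> P i) \<and> (\<forall>i<n. P i \<subset> P (Suc i))}"

fun regular_seq :: "'a::comm_ring_1 list \<Rightarrow> 'a set \<Rightarrow> 'a set \<Rightarrow> bool" where
  "regular_seq [] N L \<longleftrightarrow> N \<noteq> L"
| "regular_seq (a # as) N L \<longleftrightarrow>
     (\<forall>x\<in>N. a * x \<in> L \<longrightarrow> x \<in> L) \<and> regular_seq as N {y + a * x | x y. x \<in> N \<and> y \<in> L}"

definition depth :: "'a::comm_ring_1 set \<Rightarrow> 'a set \<Rightarrow> 'a set \<Rightarrow> enat" where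
  "depth \<mm> N L = Sup {enat (length as) | as. set as \<subseteq> \<mm> \<and> regular_seq as N L}"


section \<open>Relative complexes and their face modules\<close>

text \<open>
  The void complex \<open>{}\<close> is admitted (and differs from \<open>{{}}\<close>); not every element of the vertex type
  has to be a vertex of the complex.
\<close>

definition simplicial_complex :: "'v::finite set set \<Rightarrow> bool" where
  "simplicial_complex \<Delta> \<longleftrightarrow> (\<forall>F\<in>\<Delta>. \<forall>G. G \<subseteq> F \<longrightarrow> G \<in> \<Delta>)"

type_synonym 'v rel_cx = "'v set set \<times> 'v set set"

definition relative_complex :: "'v::finite rel_cx \<Rightarrow> bool" where
  "relative_complex \<Psi> \<longleftrightarrow>
     simplicial_complex (fst \<Psi>) \<and> simplicial_complex (snd \<Psi>) \<and> snd \<Psi> \<subset> fst \<Psi>"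

definition rel_faces :: "'v::finite rel_cx \<Rightarrow> 'v set set" where
  "rel_faces \<Psi> = fst \<Psi> - snd \<Psi>"

definition rel_dim :: "'v::finite rel_cx \<Rightarrow> int" where
  "rel_dim \<Psi> = Max ((\<lambda>F. int (card F) - 1) ` rel_faces \<Psi>)"

definition relative_subcomplex :: "'v::finite rel_cx \<Rightarrow> 'v rel_cx \<Rightarrow> bool" where
  "relative_subcomplex \<Psi>' \<Psi> \<longleftrightarrow>
     relative_complex \<Psi>' \<and> fst \<Psi>' \<subseteq> fst \<Psi> \<and> snd \<Psi>' \<subseteq> snd \<Psi>"

definition full_in :: "'v::finite rel_cx \<Rightarrow> 'v rel_cx \<Rightarrow> bool" where
  "full_in \<Psi>' \<Psi> \<longleftrightarrow> (\<forall>F\<in>fst \<Psi>. F \<subseteq> \<Union>(fst \<Psi>') \<longrightarrow> F \<in> fst \<Psi>')"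

definition rel_pair :: "'v::finite rel_cx \<Rightarrow> 'v rel_cx \<Rightarrow> 'v rel_cx" where
  "rel_pair \<Psi> \<Psi>' = (fst \<Psi>, snd \<Psi> \<union> fst \<Psi>')"

text \<open>The polynomial ring over \<open>'k\<close> with one variable for each element of \<open>'v\<close>.\<close>

type_synonym ('v, 'k) mpolynomial = "('v \<Rightarrow>\<^sub>0 nat) \<Rightarrow>\<^sub>0 'k"

definition variable :: "'v::finite \<Rightarrow> ('v, 'k::field) mpolynomial" where
  "variable v = Poly_Mapping.single (Poly_Mapping.single v 1) 1"

definition irrelevant_ideal :: "('v::finite, 'k::field) mpolynomial set" where
  "irrelevant_ideal = ideal_gen (range variable)"

text \<open>For the void complex this is the whole ring, since the empty set is then a nonface.\<close>

definition stanley_reisner_ideal :: "'v::finite set set \<Rightarrow> ('v, 'k::field) mpolynomial set" where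
  "stanley_reisner_ideal \<Delta> = ideal_gen {\<Prod>v\<in>F. variable v | F. F \<notin> \<Delta>}"

text \<open>The face module of \<open>(\<Delta>, \<Gamma>)\<close> is the quotient of the ideal of \<open>\<Gamma>\<close> by the ideal of \<open>\<Delta>\<close>.\<close>

definition cohen_macaulay :: "'k::field itself \<Rightarrow> 'v::finite rel_cx \<Rightarrow> bool" where
  "cohen_macaulay K \<Psi> \<longleftrightarrow>
     (let N = stanley_reisner_ideal (snd \<Psi>) :: ('v, 'k) mpolynomial set;
          L = stanley_reisner_ideal (fst \<Psi>)
      in depth irrelevant_ideal N L = krull_dim N L)"


section \<open>Face numbers and h-vectors\<close>

definition f_num :: "'v::finite rel_cx \<Rightarrow> int \<Rightarrow> nat" where
  "f_num \<Psi> i = card {F \<in> rel_faces \<Psi>. int (card F) - 1 = i}"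

definition h_poly :: "nat \<Rightarrow> 'v::finite rel_cx \<Rightarrow> int poly" where
  "h_poly D \<Psi> =
     (\<Sum>k=0..D. of_nat (f_num \<Psi> (int k - 1)) * [:0, 1:] ^ k * [:1, -1:] ^ (D - k))"

text \<open>Indexed by all integers, with the convention that entries of negative index vanish.\<close>

definition h_vec :: "nat \<Rightarrow> 'v::finite rel_cx \<Rightarrow> int \<Rightarrow> int" where
  "h_vec D \<Psi> k = (if k < 0 then 0 else coeff (h_poly D \<Psi>) (nat k))"

text \<open>
  A pitfall: \<^const>\<open>relative_subcomplex\<close> alone does not force the faces of \<open>\<Psi>'\<close> to be faces of \<open>\<Psi>\<close>,
  because a face of \<open>\<Delta>'\<close> that is not in \<open>\<Gamma>'\<close> may still lie in \<open>\<Gamma>\<close>. Without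
  \<open>rel_faces \<Psi>' \<subseteq> rel_faces \<Psi>\<close> (that is, \<open>\<Gamma>' = \<Gamma> \<inter> \<Delta>'\<close>) the face module of \<open>\<Psi>'\<close> is not a quotient
  of that of \<open>\<Psi>\<close>, and the inequality \<open>h\<^sub>k(\<Psi>, \<Psi>') \<ge> h\<^sub>k\<^sub>-\<^sub>1(\<Psi>')\<close> for a full Cohen--Macaulay relative
  subcomplex of codimension one fails: take \<open>\<Delta>\<close> an edge \<open>ab\<close> with all its faces, \<open>\<Gamma>\<close> its boundary,
  \<open>\<Delta>' = {{}, {a}}\<close> and \<open>\<Gamma>' = {}\<close>; then \<open>h\<^sub>1(\<Psi>, \<Psi>') = 0 < 1 = h\<^sub>0(\<Psi>')\<close>.
\<close>

end

theory Submission
  imports Defs "HOL-Library.FuncSet" "HOL-Computational_Algebra.Polynomial_FPS"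
begin

text \<open>
  Since \<open>h\<^sub>k(\<Psi>, \<Psi>') = h\<^sub>k(\<Psi>) - h\<^sub>k(\<Psi>') + h\<^sub>k\<^sub>-\<^sub>1(\<Psi>')\<close>, the claim is the monotonicity \<open>h\<^sub>k(\<Psi>') \<le> h\<^sub>k(\<Psi>)\<close>.
  The face module \<open>M'\<close> of \<open>\<Psi>'\<close> is a quotient of the face module \<open>M\<close> of \<open>\<Psi>\<close>. As \<open>\<Psi>'\<close> is full of
  codimension one, every face of \<open>\<Psi>\<close> of maximal dimension has a vertex outside \<open>\<Delta>'\<close>, so over an
  infinite field there are linear forms \<open>\<theta>\<^sub>1, \<dots>, \<theta>\<^sub>d\<close> that are parameters for \<open>M\<close> such that
  \<open>\<theta>\<^sub>1, \<dots>, \<theta>\<^sub>d\<^sub>-\<^sub>1\<close> are parameters for \<open>M'\<close> and \<open>\<theta>\<^sub>d\<close> involves only variables that vanish on \<open>M'\<close>.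
  Then \<open>M / \<theta>M\<close> maps onto \<open>M' / (\<theta>\<^sub>1, \<dots>, \<theta>\<^sub>d\<^sub>-\<^sub>1)M'\<close>, and by Cohen--Macaulayness the Hilbert functions
  of these two quotients are the h-vectors.

  That linear parameters form a regular sequence is obtained from Koszul cohomology. A regular
  sequence of length \<open>d\<close> in the irrelevant ideal makes the Koszul cohomology of \<open>M\<close> with respect to
  the variables vanish below degree \<open>d\<close>; this persists when \<open>\<theta>\<close> is adjoined, and the variables can then
  be removed because they are nilpotent modulo \<open>(\<theta>)\<close> and the annihilator of \<open>M\<close>.
\<close>

section \<open>Ideals\<close>

lemma module_times: "module ((*) :: 'a::comm_ring_1 \<Rightarrow> 'a \<Rightarrow> 'a)"
  by unfold_locales (simp_all add: algebra_simps)

lemma ring_ideal_iff: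
  "ring_ideal (I :: 'a::comm_ring_1 set) \<longleftrightarrow>
     0 \<in> I \<and> (\<forall>x\<in>I. \<forall>y\<in>I. x + y \<in> I) \<and> (\<forall>c. \<forall>x\<in>I. c * x \<in> I)"
  unfolding ring_ideal_def module.subspace_def[OF module_times] ..

lemma
  assumes "ring_ideal (I :: 'a::comm_ring_1 set)"
  shows ideal_zero: "0 \<in> I"
    and ideal_add: "x \<in> I \<Longrightarrow> y \<in> I \<Longrightarrow> x + y \<in> I"
    and ideal_mult: "x \<in> I \<Longrightarrow> c * x \<in> I"
    and ideal_mult_right: "x \<in> I \<Longrightarrow> x * c \<in> I"
    and ideal_uminus: "x \<in> I \<Longrightarrow> - x \<in> I"
    and ideal_diff: "x \<in> I \<Longrightarrow> y \<in> I \<Longrightarrow> x - y \<in> I"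
proof -
  note * = assms[unfolded ring_ideal_iff]
  show "0 \<in> I" "x \<in> I \<Longrightarrow> y \<in> I \<Longrightarrow> x + y \<in> I" and m: "\<And>c x. x \<in> I \<Longrightarrow> c * x \<in> I"
    using * by blast+
  show "x \<in> I \<Longrightarrow> x * c \<in> I" using m[of x c] by (simp add: mult.commute)
  show u: "\<And>x. x \<in> I \<Longrightarrow> - x \<in> I" using m[of _ "- 1"] by simp
  show "x \<in> I \<Longrightarrow> y \<in> I \<Longrightarrow> x - y \<in> I" using * u by (metis diff_conv_add_uminus)
qed

lemmas ideal_intros = ideal_zero ideal_add ideal_mult ideal_mult_right ideal_uminus ideal_diff

lemma ideal_sum:
  assumes "ring_ideal I" "\<And>x. x \<in> A \<Longrightarrow> f x \<in> I"
  shows "sum f A \<in> I"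
  using assms(2) by (induction A rule: infinite_finite_induct) (auto intro: ideal_intros[OF assms(1)])

lemma ring_ideal_ideal_gen: "ring_ideal (ideal_gen B)"
  unfolding ring_ideal_def ideal_gen_def by (rule module.subspace_span[OF module_times])

lemma ideal_gen_superset: "B \<subseteq> ideal_gen B"
  unfolding ideal_gen_def by (rule module.span_superset[OF module_times])

lemma ideal_gen_least: "B \<subseteq> I \<Longrightarrow> ring_ideal I \<Longrightarrow> ideal_gen B \<subseteq> I"
  unfolding ideal_gen_def ring_ideal_def by (rule module.span_minimal[OF module_times])

section \<open>Koszul cochains\<close>

text \<open>
  Subsets of \<open>{0..<n}\<close> are encoded as Boolean lists of length \<open>n\<close>. Splitting on the head then presents
  the complex of \<open>a # as\<close> as the mapping cone of multiplication by \<open>a\<close> on the complex of \<open>as\<close>.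
\<close>

definition cochains :: "nat \<Rightarrow> int \<Rightarrow> 'a::zero set \<Rightarrow> (bool list \<Rightarrow> 'a) set" where
  "cochains n i N =
     {u. (\<forall>b. u b \<in> N) \<and> (\<forall>b. u b \<noteq> 0 \<longrightarrow> length b = n \<and> int (count_list b True) = i)}"

text \<open>The minus sign in the \<open>True\<close> clause is the sign of the mapping cone. It
  makes the two terms with factor \<open>a\<close> cancel when the differential is applied
  twice.\<close>

fun koszul :: "'a::comm_ring_1 list \<Rightarrow> (bool list \<Rightarrow> 'a) \<Rightarrow> bool list \<Rightarrow> 'a" where
  "koszul (a # as) u (False # b) = koszul as (\<lambda>c. u (False # c)) b"
| "koszul (a # as) u (True # b) = a * u (False # b) - koszul as (\<lambda>c. u (True # c)) b"
| "koszul _ u _ = 0"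

definition join :: "(bool list \<Rightarrow> 'a::zero) \<Rightarrow> (bool list \<Rightarrow> 'a) \<Rightarrow> bool list \<Rightarrow> 'a" where
  "join f g b = (case b of [] \<Rightarrow> 0 | c # b' \<Rightarrow> if c then g b' else f b')"

lemma join_simps [simp]:
  "join f g (False # b) = f b" "join f g (True # b) = g b" "join f g [] = 0"
  by (simp_all add: join_def)

lemma all_bool_list: "(\<forall>b. P b) \<longleftrightarrow> P [] \<and> (\<forall>b. P (False # b)) \<and> (\<forall>b. P (True # b))"
  by (metis (full_types) list.exhaust)

text \<open>The empty list has the wrong length, so a cochain vanishes there, which also puts
  \<open>0\<close> into \<open>N\<close>. Degrees are integers, so the \<open>True\<close> half may
  sit in degree \<open>i - 1\<close> even for \<open>i = 0\<close>, where it is forced to be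
  zero.\<close>

lemma cochains_Suc:
  "u \<in> cochains (Suc n) i N \<longleftrightarrow> (\<lambda>b. u (False # b)) \<in> cochains n i N \<and>
     (\<lambda>b. u (True # b)) \<in> cochains n (i - 1) N \<and> u [] = 0 \<and> 0 \<in> N"
  unfolding cochains_def mem_Collect_eq
  by (subst (1 2) all_bool_list) force

lemma cochains_eq_0_length: "u \<in> cochains n i N \<Longrightarrow> length b \<noteq> n \<Longrightarrow> u b = 0"
  by (auto simp: cochains_def)

lemma join_in_cochains:
  "f \<in> cochains n i N \<Longrightarrow> g \<in> cochains n (i - 1) N \<Longrightarrow> 0 \<in> N \<Longrightarrow> join f g \<in> cochains (Suc n) i N"
  by (simp add: cochains_Suc)

lemma koszul_add: "koszul as (\<lambda>b. u b + v b) b = koszul as u b + koszul as v b"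
proof (induction as u b arbitrary: v rule: koszul.induct)
  case (1 a as u b)
  then show ?case by simp
next
  case (2 a as u b)
  show ?case using 2[of "\<lambda>b. v (True # b)"] by (simp add: algebra_simps)
qed simp_all

lemma koszul_mult: "koszul as (\<lambda>b. r * u b) b = r * koszul as u b"
  by (induction as u b rule: koszul.induct) (simp_all add: algebra_simps)

lemma koszul_diff: "koszul as (\<lambda>b. u b - v b) b = koszul as u b - koszul as v b"
  using koszul_add[of as u "\<lambda>b. - 1 * v b"] koszul_mult[of as "- 1" v] by simp

lemma koszul_zero [simp]: "koszul as (\<lambda>b. 0) b = 0"
  using koszul_mult[of as 0 "\<lambda>b. 0"] by simp

lemma koszul_koszul: "koszul as (koszul as u) b = 0"
proof (induction as u b rule: koszul.induct)
  case (2 a as u b)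
  then show ?case by (simp add: koszul_diff koszul_mult)
qed simp_all

lemma koszul_ideal:
  assumes "ring_ideal I"
  shows "(\<And>b. u b \<in> I) \<Longrightarrow> koszul as u b \<in> I"
  by (induction as u b rule: koszul.induct) (auto intro: ideal_intros[OF assms])

lemma
  assumes N: "ring_ideal N" and u: "u \<in> cochains n i N"
  shows cochains_mult: "(\<lambda>b. r * u b) \<in> cochains n i N"
    and cochains_uminus: "(\<lambda>b. - u b) \<in> cochains n i N"
    and cochains_add: "v \<in> cochains n i N \<Longrightarrow> (\<lambda>b. u b + v b) \<in> cochains n i N"
    and cochains_diff: "v \<in> cochains n i N \<Longrightarrow> (\<lambda>b. u b - v b) \<in> cochains n i N"
proof -
  note * = u[unfolded cochains_def mem_Collect_eq] ideal_intros[OF N]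
  show "(\<lambda>b. r * u b) \<in> cochains n i N" "(\<lambda>b. - u b) \<in> cochains n i N"
    unfolding cochains_def using * by (auto, (metis mult_zero_right)+)
  show "(\<lambda>b. u b + v b) \<in> cochains n i N" "(\<lambda>b. u b - v b) \<in> cochains n i N"
    if v: "v \<in> cochains n i N"
    unfolding cochains_def using * v[unfolded cochains_def mem_Collect_eq]
    by (auto, (metis add_0 diff_0_right)+)
qed

lemma koszul_in_cochains:
  assumes "ring_ideal N" "u \<in> cochains (length as) i N"
  shows "koszul as u \<in> cochains (length as) (i + 1) N"
  using assms(2)
proof (induction as arbitrary: u i)
  case Nil
  have "koszul [] u = (\<lambda>b. 0)" by auto
  then show ?case by (auto simp: cochains_def ideal_zero[OF assms(1)])
next
  case (Cons a as)
  have u: "(\<lambda>b. u (False # b)) \<in> cochains (length as) i N"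
    "(\<lambda>b. u (True # b)) \<in> cochains (length as) (i - 1) N"
    using Cons.prems by (simp_all add: cochains_Suc)
  have "(\<lambda>b. a * u (False # b)) \<in> cochains (length as) i N"
    by (rule cochains_mult[OF assms(1) u(1)])
  moreover have "koszul as (\<lambda>b. u (True # b)) \<in> cochains (length as) i N"
    using Cons.IH[OF u(2)] by simp
  ultimately have "(\<lambda>b. a * u (False # b) - koszul as (\<lambda>b. u (True # b)) b) \<in> cochains (length as) i N"
    by (rule cochains_diff[OF assms(1)])
  then show ?case
    using Cons.IH[OF u(1)] by (simp add: cochains_Suc ideal_zero[OF assms(1)])
qed

lemma cochains_zero: "ring_ideal N \<Longrightarrow> (\<lambda>b. 0) \<in> cochains n i N"
  by (simp add: cochains_def ideal_zero)

section \<open>Vanishing of Koszul cohomology\<close>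

text \<open>Coefficients are in the module \<open>N / L\<close>, written on representatives.\<close>

definition cocycle :: "'a::comm_ring_1 list \<Rightarrow> int \<Rightarrow> 'a set \<Rightarrow> 'a set \<Rightarrow> (bool list \<Rightarrow> 'a) \<Rightarrow> bool" where
  "cocycle as i N L u \<longleftrightarrow> u \<in> cochains (length as) i N \<and> (\<forall>b. koszul as u b \<in> L)"

definition coboundary :: "'a::comm_ring_1 list \<Rightarrow> int \<Rightarrow> 'a set \<Rightarrow> 'a set \<Rightarrow> (bool list \<Rightarrow> 'a) \<Rightarrow> bool" where
  "coboundary as i N L u \<longleftrightarrow>
     (\<exists>w \<in> cochains (length as) (i - 1) N. \<forall>b. u b - koszul as w b \<in> L)"

text \<open>For finitely generated modules over a Noetherian ring this says that the ideal generated
  by \<open>as\<close> has grade at least \<open>d\<close> on \<open>N / L\<close>.\<close>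

definition koszul_acyclic :: "nat \<Rightarrow> 'a::comm_ring_1 list \<Rightarrow> 'a set \<Rightarrow> 'a set \<Rightarrow> bool" where
  "koszul_acyclic d as N L \<longleftrightarrow> (\<forall>i<int d. \<forall>u. cocycle as i N L u \<longrightarrow> coboundary as i N L u)"

lemma koszul_acyclicD:
  "koszul_acyclic d as N L \<Longrightarrow> i < int d \<Longrightarrow> cocycle as i N L u \<Longrightarrow> coboundary as i N L u"
  by (simp add: koszul_acyclic_def)

lemma koszul_acyclic_mono: "koszul_acyclic d as N L \<Longrightarrow> d' \<le> d \<Longrightarrow> koszul_acyclic d' as N L"
  by (simp add: koszul_acyclic_def)

lemma cocycle_Cons:
  assumes "0 \<in> L"
  shows "cocycle (a # as) i N L u \<longleftrightarrow>
    u [] = 0 \<and> 0 \<in> N \<and> cocycle as i N L (\<lambda>b. u (False # b)) \<and>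
    (\<lambda>b. u (True # b)) \<in> cochains (length as) (i - 1) N \<and>
    (\<forall>b. a * u (False # b) - koszul as (\<lambda>c. u (True # c)) b \<in> L)"
  unfolding cocycle_def by (subst all_bool_list) (auto simp: cochains_Suc assms)

lemma cocycle_mult:
  assumes "ring_ideal N" "ring_ideal L" "cocycle as i N L u"
  shows "cocycle as i N L (\<lambda>b. r * u b)"
  using assms by (auto simp: cocycle_def koszul_mult intro: cochains_mult ideal_intros)

text \<open>In the long exact sequence of the mapping cone, degree \<open>i\<close> for
  \<open>a # as\<close> lies between degrees \<open>i - 1\<close> and \<open>i\<close> for
  \<open>as\<close>, and both vanish.\<close>

lemma koszul_acyclic_Cons:
  assumes N: "ring_ideal N" and L: "ring_ideal L" and ac: "koszul_acyclic d as N L"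
  shows "koszul_acyclic d (a # as) N L"
  unfolding koszul_acyclic_def
proof (intro allI impI)
  fix i :: int and u assume i: "i < int d" and u: "cocycle (a # as) i N L u"
  define f g where "f = (\<lambda>b. u (False # b))" and "g = (\<lambda>b. u (True # b))"
  have u0: "u [] = 0" and f: "cocycle as i N L f" and g: "g \<in> cochains (length as) (i - 1) N"
    and fg: "\<And>b. a * f b - koszul as g b \<in> L"
    using u unfolding cocycle_Cons[OF ideal_zero[OF L]] f_def g_def by auto
  obtain w where w: "w \<in> cochains (length as) (i - 1) N" "\<And>b. f b - koszul as w b \<in> L"
    using koszul_acyclicD[OF ac i f] by (auto simp: coboundary_def)
  \<comment> \<open>With \<open>w\<close> a primitive of the first half, \<open>h\<close> is the
    mismatch in the second half. It is a cocycle one degree lower, so its primitive completes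
    \<open>w\<close> to a primitive of \<open>u\<close>.\<close>
  define h where "h b = a * w b - g b" for b
  have "cocycle as (i - 1) N L h"
    unfolding cocycle_def
  proof (intro conjI allI)
    show "h \<in> cochains (length as) (i - 1) N"
      unfolding h_def by (intro cochains_diff cochains_mult N w g)
    fix b
    have "koszul as h b = (a * f b - koszul as g b) - a * (f b - koszul as w b)"
      by (simp add: h_def[abs_def] koszul_diff koszul_mult algebra_simps)
    then show "koszul as h b \<in> L" using fg w(2) by (auto intro: ideal_intros[OF L])
  qed
  then obtain v where v: "v \<in> cochains (length as) (i - 1 - 1) N" "\<And>b. h b - koszul as v b \<in> L"
    using koszul_acyclicD[OF ac, of "i - 1" h] i by (auto simp: coboundary_def)
  show "coboundary (a # as) i N L u"
    unfolding coboundary_def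
  proof (intro bexI[of _ "join w v"])
    show "join w v \<in> cochains (length (a # as)) (i - 1) N"
      using w v ideal_zero[OF N] by (simp add: join_in_cochains)
    have "g b - (a * w b - koszul as v b) \<in> L" for b
      using ideal_uminus[OF L v(2)[of b]] by (simp add: h_def algebra_simps)
    then show "\<forall>b. u b - koszul (a # as) (join w v) b \<in> L"
      by (subst all_bool_list) (use w(2) u0 ideal_zero[OF L] in \<open>simp add: f_def g_def\<close>)
  qed
qed

lemma koszul_acyclic_append:
  assumes "ring_ideal N" "ring_ideal L" "koszul_acyclic d as N L"
  shows "koszul_acyclic d (bs @ as) N L"
  by (induction bs) (use assms in \<open>auto intro: koszul_acyclic_Cons\<close>)

subsection \<open>The ideal generated by the sequence kills the cohomology\<close>

text \<open>Interior multiplication in the exterior algebra: at a subset avoiding position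
  \<open>n\<close> it reads \<open>u\<close> at the subset enlarged by \<open>n\<close>, with one
  sign for each earlier \<open>True\<close>; at the other subsets it is zero.\<close>

primrec contraction :: "nat \<Rightarrow> (bool list \<Rightarrow> 'a::comm_ring_1) \<Rightarrow> bool list \<Rightarrow> 'a" where
  "contraction 0 u = join (\<lambda>b. u (True # b)) (\<lambda>b. 0)"
| "contraction (Suc n) u =
     join (contraction n (\<lambda>b. u (False # b))) (\<lambda>b. - contraction n (\<lambda>b. u (True # b)) b)"

lemma contraction_diff:
  "contraction n (\<lambda>b. u b - v b) b = contraction n u b - contraction n v b"
  by (induction n arbitrary: u v b) (auto simp: join_def split: list.split)

lemma contraction_mult: "contraction n (\<lambda>b. r * u b) b = r * contraction n u b"
  by (induction n arbitrary: u b) (auto simp: join_def split: list.split)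

lemma contraction_ideal:
  assumes "ring_ideal I"
  shows "(\<And>b. u b \<in> I) \<Longrightarrow> contraction n u b \<in> I"
  by (induction n arbitrary: u b) (auto simp: join_def split: list.split intro: ideal_intros[OF assms])

lemma contraction_in_cochains:
  assumes "ring_ideal N" "u \<in> cochains m i N" "n < m"
  shows "contraction n u \<in> cochains m (i - 1) N"
  using assms(2,3)
proof (induction n arbitrary: u m i)
  case 0
  then show ?case
    by (cases m) (auto simp: cochains_Suc assms(1) ideal_zero cochains_zero)
next
  case (Suc n)
  then obtain k where m: "m = Suc k" "n < k" by (cases m) auto
  then have "contraction n (\<lambda>b. u (False # b)) \<in> cochains k (i - 1) N"
    "contraction n (\<lambda>b. u (True # b)) \<in> cochains k (i - 1 - 1) N"
    using Suc.prems(1) unfolding m(1) cochains_Suc by (blast intro: Suc.IH m(2))+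
  then show ?case
    using cochains_uminus[OF assms(1)] ideal_zero[OF assms(1)] by (simp add: m cochains_Suc)
qed

text \<open>Multiplication by an entry of the sequence is null-homotopic on the Koszul complex, with
  \<open>contraction n\<close> as the homotopy.\<close>

lemma contraction_homotopy:
  assumes "u \<in> cochains (length as) i N" "n < length as"
  shows "koszul as (contraction n u) b + contraction n (koszul as u) b = as ! n * u b"
  using assms
proof (induction as arbitrary: u n b i)
  case Nil
  then show ?case by simp
next
  case (Cons a as)
  have u: "(\<lambda>b. u (False # b)) \<in> cochains (length as) i N"
    "(\<lambda>b. u (True # b)) \<in> cochains (length as) (i - 1) N" and u0: "u [] = 0"
    using Cons.prems by (simp_all add: cochains_Suc)
  show ?case
  proof (cases n)
    case 0
    then show ?thesis
      by (cases b; cases "hd b") (auto simp: u0 koszul_koszul)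
  next
    case (Suc m)
    then have m: "m < length as" using Cons.prems by simp
    note IH = Cons.IH[OF u(1) m] Cons.IH[OF u(2) m]
    show ?thesis
    proof (cases b)
      case Nil
      then show ?thesis by (simp add: Suc u0)
    next
      case (Cons c b')
      have neg: "koszul as (\<lambda>b. - v b) b' = - koszul as v b'" for v
        using koszul_mult[of as "-1" v b'] by simp
      show ?thesis
        using IH(1)[of b'] IH(2)[of b']
        by (cases c) (simp_all add: Cons Suc neg contraction_diff contraction_mult algebra_simps)
    qed
  qed
qed

definition cohomology_annihilator :: "'a::comm_ring_1 list \<Rightarrow> int \<Rightarrow> 'a set \<Rightarrow> 'a set \<Rightarrow> 'a set" where
  "cohomology_annihilator as i N L =
     {r. \<forall>u. cocycle as i N L u \<longrightarrow> coboundary as i N L (\<lambda>b. r * u b)}"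

lemma ring_ideal_cohomology_annihilator:
  assumes N: "ring_ideal N" and L: "ring_ideal L"
  shows "ring_ideal (cohomology_annihilator as i N L)"
  unfolding ring_ideal_iff
proof (intro conjI allI ballI)
  show "0 \<in> cohomology_annihilator as i N L"
    by (auto simp: cohomology_annihilator_def coboundary_def
        intro!: bexI[of _ "\<lambda>b. 0"] cochains_zero[OF N] ideal_zero[OF L])
next
  fix x y assume xy: "x \<in> cohomology_annihilator as i N L" "y \<in> cohomology_annihilator as i N L"
  show "x + y \<in> cohomology_annihilator as i N L"
    unfolding cohomology_annihilator_def mem_Collect_eq
  proof (intro allI impI)
    fix u assume "cocycle as i N L u"
    then obtain v w where "v \<in> cochains (length as) (i - 1) N" "w \<in> cochains (length as) (i - 1) N"
      and vw: "\<And>b. x * u b - koszul as v b \<in> L" "\<And>b. y * u b - koszul as w b \<in> L"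
      using xy unfolding cohomology_annihilator_def coboundary_def by blast
    moreover have "(x + y) * u b - koszul as (\<lambda>b. v b + w b) b \<in> L" for b
      using ideal_add[OF L vw(1)[of b] vw(2)[of b]] by (simp add: koszul_add algebra_simps)
    ultimately show "coboundary as i N L (\<lambda>b. (x + y) * u b)"
      unfolding coboundary_def by (blast intro: cochains_add[OF N])
  qed
next
  fix c x assume x: "x \<in> cohomology_annihilator as i N L"
  show "c * x \<in> cohomology_annihilator as i N L"
    using x cocycle_mult[OF N L, of as i _ c]
    by (fastforce simp: cohomology_annihilator_def mult.left_commute mult.assoc)
qed

lemma annihilator_subset_cohomology_annihilator:
  assumes "ring_ideal N" "ring_ideal L"
  shows "annihilator N L \<subseteq> cohomology_annihilator as i N L"
proof
  fix r assume r: "r \<in> annihilator N L"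
  show "r \<in> cohomology_annihilator as i N L"
    unfolding cohomology_annihilator_def coboundary_def mem_Collect_eq
    by (intro allI impI bexI[of _ "\<lambda>b. 0"])
       (use r in \<open>auto simp: cocycle_def cochains_def annihilator_def ideal_zero[OF assms(1)]\<close>)
qed

text \<open>On a cocycle the homotopy formula exhibits \<open>as ! n * u\<close> as a coboundary
  modulo \<open>L\<close>. As the annihilator of cohomology is an ideal, the generators
  suffice.\<close>

lemma ideal_gen_subset_cohomology_annihilator:
  assumes N: "ring_ideal N" and L: "ring_ideal L"
  shows "ideal_gen (set as) \<subseteq> cohomology_annihilator as i N L"
proof (rule ideal_gen_least[OF subsetI ring_ideal_cohomology_annihilator[OF N L]])
  fix a assume "a \<in> set as"
  then obtain n where n: "n < length as" "as ! n = a" by (auto simp: in_set_conv_nth)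
  show "a \<in> cohomology_annihilator as i N L"
    unfolding cohomology_annihilator_def coboundary_def mem_Collect_eq
  proof (intro allI impI bexI)
    fix u b assume u: "cocycle as i N L u"
    then show "contraction n u \<in> cochains (length as) (i - 1) N"
      by (intro contraction_in_cochains N n(1)) (simp add: cocycle_def)
    have "contraction n (koszul as u) b \<in> L"
      using u by (intro contraction_ideal[OF L]) (simp add: cocycle_def)
    then show "a * u b - koszul as (contraction n u) b \<in> L"
      using contraction_homotopy[of u as i N n b] u n
      by (metis add_diff_cancel_left' cocycle_def)
  qed
qed

subsection \<open>Regular sequences and acyclicity\<close>

lemma ring_ideal_add_mult:
  assumes N: "ring_ideal N" and L: "ring_ideal L"
  shows "ring_ideal {y + a * x | x y. x \<in> N \<and> y \<in> L}"
  unfolding ring_ideal_iff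
proof (safe)
  show "\<exists>x y. 0 = y + a * x \<and> x \<in> N \<and> y \<in> L"
    using ideal_zero[OF N] ideal_zero[OF L] by (intro exI[of _ 0]) simp
next
  fix x y x' y' assume "x \<in> N" "y \<in> L" "x' \<in> N" "y' \<in> L"
  then show "\<exists>x'' y''. y + a * x + (y' + a * x') = y'' + a * x'' \<and> x'' \<in> N \<and> y'' \<in> L"
    by (intro exI[of _ "x + x'"] exI[of _ "y + y'"]) (auto simp: algebra_simps intro: ideal_add N L)
next
  fix c x y assume "x \<in> N" "y \<in> L"
  then show "\<exists>x'' y''. c * (y + a * x) = y'' + a * x'' \<and> x'' \<in> N \<and> y'' \<in> L"
    by (intro exI[of _ "c * x"] exI[of _ "c * y"]) (auto simp: algebra_simps intro: ideal_mult N L)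
qed

text \<open>Consider the long exact sequence of multiplication by \<open>a\<close> on
  \<open>N / L\<close>. Since \<open>a\<close> lies in the ideal of \<open>xs\<close>, it acts as
  zero on cohomology, so degree \<open>i\<close> is a quotient of degree \<open>i - 1\<close> with
  coefficients modulo \<open>a\<close>, which vanishes.\<close>

lemma koszul_acyclic_of_regular_element:
  assumes N: "ring_ideal N" and L: "ring_ideal L" and a: "a \<in> ideal_gen (set xs)"
    and reg: "\<forall>x\<in>N. a * x \<in> L \<longrightarrow> x \<in> L"
    and ac: "koszul_acyclic d xs N {y + a * x | x y. x \<in> N \<and> y \<in> L}"
  shows "koszul_acyclic (Suc d) xs N L"
  unfolding koszul_acyclic_def
proof (intro allI impI)
  define L' where "L' = {y + a * x | x y. x \<in> N \<and> y \<in> L}"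
  fix i :: int and f assume i: "i < int (Suc d)" and f: "cocycle xs i N L f"
  obtain g where g: "g \<in> cochains (length xs) (i - 1) N" "\<And>b. a * f b - koszul xs g b \<in> L"
    using ideal_gen_subset_cohomology_annihilator[OF N L] a f
    unfolding cohomology_annihilator_def coboundary_def by blast
  have "koszul xs g b \<in> L'" for b
  proof -
    have "koszul xs g b = - (a * f b - koszul xs g b) + a * f b" by simp
    then show ?thesis using g(2)[of b] f ideal_uminus[OF L]
      unfolding L'_def cocycle_def cochains_def by blast
  qed
  then have "cocycle xs (i - 1) N L' g" using g by (simp add: cocycle_def)
  then have "coboundary xs (i - 1) N L' g"
    using ac i unfolding L'_def[symmetric] by (auto intro: koszul_acyclicD)
  then obtain h where h: "h \<in> cochains (length xs) (i - 1 - 1) N"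
    "\<And>b. g b - koszul xs h b \<in> L'" unfolding coboundary_def by blast
  \<comment> \<open>Since \<open>k\<close> is \<open>a * e\<close> modulo \<open>L\<close> and has
    the same differential as \<open>g\<close>, applying the differential and cancelling
    \<open>a\<close> identifies \<open>f\<close> with the differential of \<open>e\<close>.\<close>
  define k where "k b = g b - koszul xs h b" for b
  have k: "k \<in> cochains (length xs) (i - 1) N"
    unfolding k_def using koszul_in_cochains[OF N h(1)] by (intro cochains_diff N g) simp
  \<comment> \<open>The quotient \<open>e\<close> must vanish wherever \<open>k\<close> does, so
    that it is again a cochain of degree \<open>i - 1\<close>.\<close>
  have "\<exists>e. e \<in> N \<and> k b - a * e \<in> L \<and> (k b = 0 \<longrightarrow> e = 0)" for b
  proof (cases "k b = 0")
    case True
    then show ?thesis using ideal_zero[OF N] ideal_zero[OF L] by auto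
  next
    case False
    then show ?thesis using h(2)[of b] unfolding k_def L'_def by force
  qed
  then obtain e where e: "\<And>b. e b \<in> N" "\<And>b. k b - a * e b \<in> L" "\<And>b. k b = 0 \<Longrightarrow> e b = 0"
    by metis
  have e': "e \<in> cochains (length xs) (i - 1) N"
    using k e unfolding cochains_def by blast
  show "coboundary xs i N L f"
    unfolding coboundary_def
  proof (intro bexI[OF _ e'] allI)
    fix b
    have "koszul xs (\<lambda>b. k b - a * e b) b \<in> L" by (rule koszul_ideal[OF L e(2)])
    then have "koszul xs g b - a * koszul xs e b \<in> L"
      by (simp add: k_def[abs_def] koszul_diff koszul_mult koszul_koszul)
    then have "a * (f b - koszul xs e b) \<in> L"
      using ideal_add[OF L g(2)[of b]] by (fastforce simp: algebra_simps)
    moreover have "f b - koszul xs e b \<in> N"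
      using f koszul_ideal[OF N e(1)] by (auto simp: cocycle_def cochains_def intro: ideal_diff[OF N])
    ultimately show "f b - koszul xs e b \<in> L" using reg by blast
  qed
qed

text \<open>Only negative degrees are concerned, and there every cochain is zero.\<close>

lemma koszul_acyclic_0: "ring_ideal N \<Longrightarrow> ring_ideal L \<Longrightarrow> koszul_acyclic 0 xs N L"
  unfolding koszul_acyclic_def cocycle_def coboundary_def
  by (intro allI impI bexI[of _ "\<lambda>b. 0"] cochains_zero) (fastforce simp: cochains_def ideal_zero)+

text \<open>One half of depth sensitivity: each element of the regular sequence raises the vanishing
  range by one. The induction varies \<open>L\<close>, which absorbs the elements already
  used.\<close>

lemma koszul_acyclic_of_regular_seq:
  assumes "ring_ideal N" "ring_ideal L" "set as \<subseteq> ideal_gen (set xs)" "regular_seq as N L"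
  shows "koszul_acyclic (length as) xs N L"
  using assms
proof (induction as arbitrary: L)
  case Nil
  then show ?case by (simp add: koszul_acyclic_0)
next
  case (Cons a as)
  then show ?case
    by (auto intro!: koszul_acyclic_of_regular_element Cons.IH ring_ideal_add_mult)
qed

subsection \<open>Removing elements that act nilpotently on the cohomology\<close>

lemma coboundary_add:
  assumes "ring_ideal N" "ring_ideal L" "coboundary as i N L u" "coboundary as i N L v"
  shows "coboundary as i N L (\<lambda>b. u b + v b)"
proof -
  obtain u' v' where u': "u' \<in> cochains (length as) (i - 1) N" "\<And>b. u b - koszul as u' b \<in> L"
    and v': "v' \<in> cochains (length as) (i - 1) N" "\<And>b. v b - koszul as v' b \<in> L"
    using assms(3,4) unfolding coboundary_def by blast
  show ?thesis
    unfolding coboundary_def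
  proof (intro bexI allI)
    show "(\<lambda>b. u' b + v' b) \<in> cochains (length as) (i - 1) N"
      by (intro cochains_add assms u' v')
    show "u b + v b - koszul as (\<lambda>b. u' b + v' b) b \<in> L" for b
      using ideal_add[OF assms(2) u'(2) v'(2), of b b] by (simp add: koszul_add algebra_simps)
  qed
qed

lemma coboundary_mult:
  assumes "ring_ideal N" "ring_ideal L" "coboundary as i N L u"
  shows "coboundary as i N L (\<lambda>b. r * u b)"
proof -
  obtain u' where u': "u' \<in> cochains (length as) (i - 1) N" "\<And>b. u b - koszul as u' b \<in> L"
    using assms(3) unfolding coboundary_def by blast
  show ?thesis
    unfolding coboundary_def
  proof (intro bexI allI)
    show "(\<lambda>b. r * u' b) \<in> cochains (length as) (i - 1) N"
      by (intro cochains_mult assms u')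
    show "r * u b - koszul as (\<lambda>b. r * u' b) b \<in> L" for b
      using ideal_mult[OF assms(2) u'(2), of r b] by (simp add: koszul_mult algebra_simps)
  qed
qed

lemma coboundary_zero:
  assumes "ring_ideal N" "\<And>b. u b \<in> L"
  shows "coboundary as i N L u"
  unfolding coboundary_def by (rule bexI[OF _ cochains_zero[OF assms(1)]]) (simp add: assms(2))

lemma coboundary_sum:
  assumes "ring_ideal N" "ring_ideal L" "\<And>x. x \<in> A \<Longrightarrow> coboundary as i N L (u x)"
  shows "coboundary as i N L (\<lambda>b. \<Sum>x\<in>A. u x b)"
  using assms(3)
proof (induction A rule: infinite_finite_induct)
  case (insert x A)
  then show ?case by (simp add: coboundary_add[OF assms(1,2)])
qed (auto intro!: coboundary_zero assms(1,2) ideal_zero)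

lemma koszul_append1_False:
  "length b = length as \<Longrightarrow>
    koszul (as @ [a]) u (b @ [False]) = koszul as (\<lambda>c. u (c @ [False])) b"
proof (induction as arbitrary: u b)
  case (Cons a' as)
  then obtain x b' where "b = x # b'" "length b' = length as" by (cases b) auto
  then show ?case using Cons.IH by (cases x) simp_all
qed simp

text \<open>\<open>koszul\<close> recurses on the head, whereas elements are later removed from the
  end of the list. Moving the last entry past the others costs one sign for each
  \<open>True\<close>.\<close>

lemma koszul_append1_True:
  "length b = length as \<Longrightarrow>
    koszul (as @ [a]) u (b @ [True]) =
      koszul as (\<lambda>c. u (c @ [True])) b + (- 1) ^ count_list b True * (a * u (b @ [False]))"
proof (induction as arbitrary: u b)
  case (Cons a' as)
  then obtain x b' where "b = x # b'" "length b' = length as" by (cases b) auto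
  then show ?case using Cons.IH by (cases x) simp_all
qed simp

text \<open>Injectivity of \<open>a\<close> on degree \<open>i\<close> for \<open>as\<close>, from
  the long exact sequence of the cone \<open>as @ [a]\<close>: if \<open>a * f\<close> bounds
  \<open>h\<close>, then \<open>f\<close> and \<open>h\<close> together form a cocycle for
  \<open>as @ [a]\<close>, and half of its primitive bounds \<open>f\<close>.\<close>

lemma coboundary_of_mult:
  assumes N: "ring_ideal N" and L: "ring_ideal L"
    and ac: "koszul_acyclic d (as @ [a]) N L" and i: "i < int d"
    and f: "cocycle as i N L f" and af: "coboundary as i N L (\<lambda>b. a * f b)"
  shows "coboundary as i N L f"
proof -
  define n where "n = length as"
  obtain h where h: "h \<in> cochains n (i - 1) N" "\<And>b. a * f b - koszul as h b \<in> L"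
    using af unfolding coboundary_def n_def by blast
  have fc: "f \<in> cochains n i N" and fL: "\<And>b. koszul as f b \<in> L"
    using f by (auto simp: cocycle_def n_def)
  \<comment> \<open>For \<open>i \<ge> 1\<close> this is opposite to the sign that \<open>a\<close>
    acquires behind \<open>i\<close> entries \<open>True\<close>, so the two contributions cancel
    modulo \<open>L\<close>. For \<open>i \<le> 0\<close> the cochain \<open>h\<close> is zero and
    the value of \<open>s\<close> is irrelevant.\<close>
  define s :: 'a where "s = (- 1) ^ nat (i - 1)"
  define u where
    "u c = (if c = [] then 0 else if last c then s * h (butlast c) else f (butlast c))" for c
  have u_snoc: "u (b @ [False]) = f b" "u (b @ [True]) = s * h b" for b
    by (simp_all add: u_def)
  have uc: "u \<in> cochains (Suc n) i N"
    unfolding cochains_def mem_Collect_eq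
  proof (intro conjI allI impI)
    fix b
    show "u b \<in> N"
      using fc h(1) by (auto simp: u_def cochains_def intro: ideal_intros[OF N])
    assume "u b \<noteq> 0"
    then obtain c x where b: "b = c @ [x]" by (cases b rule: rev_cases) (auto simp: u_def)
    have "length c = n \<and> int (count_list (c @ [x]) True) = i"
    proof (cases x)
      case True
      then have "h c \<noteq> 0" using \<open>u b \<noteq> 0\<close> by (auto simp: b u_snoc)
      then show ?thesis using h(1) True by (auto simp: cochains_def)
    next
      case False
      then have "f c \<noteq> 0" using \<open>u b \<noteq> 0\<close> by (simp add: b u_snoc)
      then show ?thesis using fc False by (auto simp: cochains_def)
    qed
    then show "length b = Suc n" "int (count_list b True) = i" by (simp_all add: b)
  qed
  have "koszul (as @ [a]) u c \<in> L" for c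
  proof (cases "length c = Suc n")
    case False
    have "koszul (as @ [a]) u \<in> cochains (Suc n) (i + 1) N"
      using koszul_in_cochains[OF N, of u "as @ [a]" i] uc by (simp add: n_def)
    then have "koszul (as @ [a]) u c = 0" using False by (rule cochains_eq_0_length)
    then show ?thesis by (simp add: ideal_zero[OF L])
  next
    case True
    then obtain b x where c: "c = b @ [x]" "length b = length as"
      by (cases c rule: rev_cases) (auto simp: n_def)
    show ?thesis
    proof (cases x)
      case False
      then show ?thesis by (simp add: c koszul_append1_False u_snoc fL)
    next
      case True
      have "s * koszul as h b + (- 1) ^ count_list b True * (a * f b) \<in> L"
      proof (cases "i \<ge> 1")
        case i: True
        have "(- 1) ^ count_list b True * (a * f b) = - s * (a * f b)"
        proof (cases "f b = 0")
          case False
          then have "count_list b True = Suc (nat (i - 1))"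
            using fc i by (auto simp: cochains_def)
          then show ?thesis by (simp add: s_def)
        qed simp
        then have "s * koszul as h b + (- 1) ^ count_list b True * (a * f b) =
            - s * (a * f b - koszul as h b)"
          by (simp add: algebra_simps)
        then show ?thesis using h(2) by (metis ideal_mult[OF L])
      next
        case False
        then have "h = (\<lambda>b. 0)" using h(1) by (fastforce simp: cochains_def)
        then show ?thesis using h(2)[of b] by (auto intro: ideal_intros[OF L])
      qed
      then show ?thesis using True by (simp add: c koszul_append1_True u_snoc koszul_mult)
    qed
  qed
  then have "cocycle (as @ [a]) i N L u" using uc by (simp add: cocycle_def n_def)
  then obtain w where w: "w \<in> cochains (Suc n) (i - 1) N" "\<And>c. u c - koszul (as @ [a]) w c \<in> L"
    using koszul_acyclicD[OF ac i] by (auto simp: coboundary_def n_def)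
  define w' where "w' b = w (b @ [False])" for b
  have w': "w' \<in> cochains n (i - 1) N"
    using w(1) unfolding cochains_def w'_def by fastforce
  have "f b - koszul as w' b \<in> L" for b
  proof (cases "length b = n")
    case True
    then show ?thesis
      using w(2)[of "b @ [False]"] by (simp add: koszul_append1_False n_def u_snoc w'_def[abs_def])
  next
    case False
    then have "f b = 0" "koszul as w' b = 0"
      using cochains_eq_0_length[OF fc]
        cochains_eq_0_length[OF koszul_in_cochains[OF N w'[unfolded n_def]]] by (simp_all add: n_def)
    then show ?thesis by (simp add: ideal_zero[OF L])
  qed
  then show ?thesis using w' unfolding coboundary_def n_def by blast
qed

text \<open>Below degree \<open>d\<close>, multiplication by \<open>a\<close> on the cohomology of
  \<open>as\<close> is both injective and nilpotent, so this cohomology is zero.\<close>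

lemma koszul_acyclic_butlast:
  assumes N: "ring_ideal N" and L: "ring_ideal L"
    and ac: "koszul_acyclic d (as @ [a]) N L"
    and nil: "\<And>i. \<exists>p. a ^ p \<in> cohomology_annihilator as i N L"
  shows "koszul_acyclic d as N L"
  unfolding koszul_acyclic_def
proof (intro allI impI)
  fix i f assume i: "i < int d" and f: "cocycle as i N L f"
  obtain p where "coboundary as i N L (\<lambda>b. a ^ p * f b)"
    using nil[of i] f unfolding cohomology_annihilator_def by blast
  then show "coboundary as i N L f"
  proof (induction p)
    case (Suc p)
    then show ?case
      using coboundary_of_mult[OF N L ac i cocycle_mult[OF N L f, of "a ^ p"]]
      by (simp add: mult.assoc)
  qed simp
qed

text \<open>Entries are removed from the end one at a time. The ideal of \<open>as\<close> and the
  annihilator of \<open>N / L\<close> both act as zero on cohomology, so nilpotence modulo the two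
  is enough.\<close>

lemma koszul_acyclic_appendD:
  assumes N: "ring_ideal N" and L: "ring_ideal L"
    and ac: "koszul_acyclic d (as @ bs) N L"
    and nil: "\<And>b. b \<in> set bs \<Longrightarrow> \<exists>p. b ^ p \<in> ideal_gen (set as \<union> annihilator N L)"
  shows "koszul_acyclic d as N L"
  using ac nil
proof (induction bs rule: rev_induct)
  case (snoc b bs)
  obtain p where p: "b ^ p \<in> ideal_gen (set as \<union> annihilator N L)" using snoc.prems by auto
  have "ideal_gen (set as \<union> annihilator N L) \<subseteq> cohomology_annihilator (as @ bs) i N L" for i
    using ideal_gen_subset_cohomology_annihilator[OF N L, of "as @ bs" i]
      ideal_gen_superset[of "set (as @ bs)"] annihilator_subset_cohomology_annihilator[OF N L, of "as @ bs" i]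
    by (intro ideal_gen_least ring_ideal_cohomology_annihilator N L) auto
  then have "koszul_acyclic d (as @ bs) N L"
    using koszul_acyclic_butlast[OF N L, of d "as @ bs" b] snoc.prems p by fastforce
  then show ?case using snoc by auto
qed simp

subsection \<open>Top cohomology\<close>

text \<open>This is \<open>L\<close> plus all multiples of the entries by elements of
  \<open>N\<close>. The recursion adjoins the head last, so lists of parameters are read from right
  to left.\<close>

fun adjoin :: "'a::comm_ring_1 list \<Rightarrow> 'a set \<Rightarrow> 'a set \<Rightarrow> 'a set" where
  "adjoin [] N L = L"
| "adjoin (a # as) N L = {y + a * x | x y. x \<in> N \<and> y \<in> adjoin as N L}"

lemma ring_ideal_adjoin: "ring_ideal N \<Longrightarrow> ring_ideal L \<Longrightarrow> ring_ideal (adjoin as N L)"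
  by (induction as) (simp_all add: ring_ideal_add_mult)

lemma adjoin_superset: "0 \<in> N \<Longrightarrow> L \<subseteq> adjoin as N L"
  by (induction as) force+

lemma adjoin_subset: "ring_ideal N \<Longrightarrow> L \<subseteq> N \<Longrightarrow> adjoin as N L \<subseteq> N"
  by (induction as) (auto intro!: ideal_add ideal_mult)

lemma count_list_True_eq_length: "count_list b True = length b \<longleftrightarrow> b = replicate (length b) True"
proof (induction b)
  case (Cons x b)
  have "count_list b True \<le> length b" by (rule count_le_length)
  then show ?case using Cons by (cases x) auto
qed simp

definition top_cochain :: "nat \<Rightarrow> 'a::zero \<Rightarrow> bool list \<Rightarrow> 'a" where
  "top_cochain n x b = (if b = replicate n True then x else 0)"

lemma top_cochain_in_cochains:
  "ring_ideal N \<Longrightarrow> x \<in> N \<Longrightarrow> top_cochain n x \<in> cochains n (int n) N"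
  using count_list_True_eq_length[of "replicate n True"]
  by (auto simp: cochains_def top_cochain_def ideal_zero)

text \<open>A cochain of top degree is a single element of \<open>N\<close>, and the coboundaries
  among these form \<open>adjoin as N L\<close>; so the top cohomology is
  \<open>N / adjoin as N L\<close>.\<close>

lemma adjoin_iff_koszul:
  assumes N: "ring_ideal N" and L: "ring_ideal L"
  shows "x \<in> adjoin as N L \<longleftrightarrow> (\<exists>g \<in> cochains (length as) (int (length as) - 1) N.
    x - koszul as g (replicate (length as) True) \<in> L)"
proof (induction as arbitrary: x)
  case Nil
  then show ?case using cochains_zero[OF N] by auto
next
  case (Cons a as)
  define n where "n = length as"
  show ?case
  proof
    assume "x \<in> adjoin (a # as) N L"
    then obtain y z g where x: "x = y + a * z" and z: "z \<in> N"
      and g: "g \<in> cochains n (int n - 1) N" "y - koszul as g (replicate n True) \<in> L"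
      using Cons unfolding n_def by auto
    have neg: "koszul as (\<lambda>b. - g b) b = - koszul as g b" for b
      using koszul_mult[of as "-1" g b] by simp
    have "join (top_cochain n z) (\<lambda>b. - g b) \<in> cochains (Suc n) (int n) N"
      using top_cochain_in_cochains[OF N z] cochains_uminus[OF N g(1)] ideal_zero[OF N]
      by (simp add: join_in_cochains)
    moreover have
      "x - koszul (a # as) (join (top_cochain n z) (\<lambda>b. - g b)) (replicate (Suc n) True) \<in> L"
      using g(2) by (simp add: x top_cochain_def neg)
    ultimately show "\<exists>g \<in> cochains (length (a # as)) (int (length (a # as)) - 1) N.
        x - koszul (a # as) g (replicate (length (a # as)) True) \<in> L"
      unfolding n_def by (intro bexI) simp_all
  next
    assume "\<exists>g \<in> cochains (length (a # as)) (int (length (a # as)) - 1) N.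
        x - koszul (a # as) g (replicate (length (a # as)) True) \<in> L"
    then obtain g where g: "g \<in> cochains (Suc n) (int n) N"
      "x - koszul (a # as) g (replicate (Suc n) True) \<in> L" unfolding n_def by auto
    define z where "z = g (False # replicate n True)"
    define g' where "g' = (\<lambda>b. - g (True # b))"
    have z: "z \<in> N" and g': "g' \<in> cochains n (int n - 1) N"
      using g(1) cochains_uminus[OF N, of "\<lambda>b. g (True # b)"]
      by (auto simp: z_def g'_def cochains_Suc) (simp add: cochains_def)
    have neg: "koszul as g' b = - koszul as (\<lambda>b. g (True # b)) b" for b
      using koszul_mult[of as "-1" "\<lambda>b. g (True # b)" b] by (simp add: g'_def)
    have "(x - a * z) - koszul as g' (replicate n True) \<in> L"
      using g(2) by (simp add: z_def neg algebra_simps)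
    then have "x - a * z \<in> adjoin as N L" using g' Cons unfolding n_def by blast
    moreover have "x = (x - a * z) + a * z" by simp
    ultimately show "x \<in> adjoin (a # as) N L"
      using z unfolding adjoin.simps mem_Collect_eq by blast
  qed
qed

text \<open>By the cone sequence, acyclicity for \<open>a # as\<close> in degree
  \<open>length as\<close> makes \<open>a\<close> injective on the top cohomology of
  \<open>as\<close>, that is, regular modulo \<open>adjoin as N L\<close>.\<close>

lemma regular_of_koszul_acyclic:
  assumes N: "ring_ideal N" and L: "ring_ideal L"
    and ac: "koszul_acyclic (Suc (length as)) (a # as) N L"
    and x: "x \<in> N" "a * x \<in> adjoin as N L"
  shows "x \<in> adjoin as N L"
proof -
  define n where "n = length as"
  obtain g where g: "g \<in> cochains n (int n - 1) N" "a * x - koszul as g (replicate n True) \<in> L"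
    using x(2) unfolding adjoin_iff_koszul[OF N L] n_def by blast
  let ?f = "top_cochain n x"
  have f: "?f \<in> cochains n (int n) N" by (rule top_cochain_in_cochains[OF N x(1)])
  have "koszul as ?f b = 0" for b
  proof -
    have "koszul as ?f \<in> cochains n (int n + 1) N"
      using koszul_in_cochains[OF N] f unfolding n_def by blast
    moreover have "count_list b True \<le> length b" by (rule count_le_length)
    ultimately show ?thesis unfolding cochains_def by force
  qed
  moreover have "a * ?f b - koszul as g b \<in> L" for b
  proof (cases "b = replicate n True")
    case False
    have "koszul as g \<in> cochains n (int n) N"
      using koszul_in_cochains[OF N, of g as "int n - 1"] g(1) unfolding n_def by simp
    then have "koszul as g b = 0"
      using False count_list_True_eq_length[of b] unfolding cochains_def by fastforce
    then show ?thesis using False by (simp add: top_cochain_def ideal_zero[OF L])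
  qed (use g(2) in \<open>simp add: top_cochain_def\<close>)
  ultimately have "cocycle (a # as) (int n) N L (join ?f g)"
    using f g(1) ideal_zero[OF N] ideal_zero[OF L]
    by (simp add: cocycle_Cons) (simp add: cocycle_def n_def)
  then obtain w where w: "w \<in> cochains (Suc n) (int n - 1) N"
    "\<And>b. join ?f g b - koszul (a # as) w b \<in> L"
    using koszul_acyclicD[OF ac, of "int n"] unfolding coboundary_def n_def by auto
  have "x - koszul as (\<lambda>b. w (False # b)) (replicate n True) \<in> L"
    using w(2)[of "False # replicate n True"] by (simp add: top_cochain_def)
  moreover have "(\<lambda>b. w (False # b)) \<in> cochains n (int n - 1) N"
    using w(1) by (simp add: cochains_Suc)
  ultimately show ?thesis unfolding adjoin_iff_koszul[OF N L] n_def by blast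
qed

section \<open>Graded rings\<close>

text \<open>A grading is presented by the projections \<open>comp e\<close> onto its components.
  Products enter only through \<open>linear_element\<close>, which expresses degree one as a shift
  of the projections.\<close>

locale grading =
  fixes comp :: "nat \<Rightarrow> 'a::comm_ring_1 \<Rightarrow> 'a"
  assumes comp_add: "comp e (x + y) = comp e x + comp e y"
    and comp_comp: "comp e (comp e' x) = (if e = e' then comp e x else 0)"
    and comp_exhaust: "\<exists>m. \<forall>m'\<ge>m. (\<Sum>e<m'. comp e x) = x"
begin

definition homogeneous :: "'a set \<Rightarrow> bool" where
  "homogeneous I \<longleftrightarrow> (\<forall>e. \<forall>x\<in>I. comp e x \<in> I)"

definition linear_element :: "'a \<Rightarrow> bool" where
  "linear_element a \<longleftrightarrow> (\<forall>e x. comp (Suc e) (a * x) = a * comp e x) \<and> (\<forall>x. comp 0 (a * x) = 0)"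

lemma comp_zero [simp]: "comp e 0 = 0"
  using comp_add[of e 0 0] by simp

lemma comp_diff: "comp e (x - y) = comp e x - comp e y"
  using comp_add[of e "x - y" y] by simp

lemma comp_koszul:
  assumes "\<And>a. a \<in> set as \<Longrightarrow> linear_element a"
  shows "comp (Suc e) (koszul as u b) = koszul as (\<lambda>b. comp e (u b)) b"
    and "comp 0 (koszul as u b) = 0"
  using assms
  by (induction as u b rule: koszul.induct) (auto simp: comp_diff linear_element_def)

lemma comp_in_cochains:
  "homogeneous N \<Longrightarrow> u \<in> cochains n i N \<Longrightarrow> (\<lambda>b. comp e (u b)) \<in> cochains n i N"
  unfolding cochains_def homogeneous_def by (auto, (metis comp_zero)+)

lemma homogeneous_adjoin:
  assumes "ring_ideal N" "ring_ideal L" "homogeneous N" "homogeneous L"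
    and "\<And>a. a \<in> set as \<Longrightarrow> linear_element a"
  shows "homogeneous (adjoin as N L)"
  using assms(5)
proof (induction as)
  case (Cons a as)
  have IH: "\<And>e x. x \<in> adjoin as N L \<Longrightarrow> comp e x \<in> adjoin as N L"
    using Cons unfolding homogeneous_def by simp
  have "\<exists>x' y'. comp e (y + a * x) = y' + a * x' \<and> x' \<in> N \<and> y' \<in> adjoin as N L"
    if "x \<in> N" "y \<in> adjoin as N L" for e x y
  proof (cases e)
    case 0
    then have "comp e (y + a * x) = comp e y + a * 0"
      using Cons.prems by (simp add: comp_add linear_element_def)
    then show ?thesis using IH that ideal_zero[OF assms(1)] by blast
  next
    case (Suc e')
    then have "comp e (y + a * x) = comp e y + a * comp e' x"
      using Cons.prems by (simp add: comp_add linear_element_def)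
    then show ?thesis using IH that assms(3) unfolding homogeneous_def by blast
  qed
  then show ?case unfolding homogeneous_def by auto
qed (use assms in simp)

text \<open>
  Multiplication by \<open>a\<close> is surjective on the cohomology of \<open>as\<close> in degrees \<open>i < d\<close>, so the graded
  Nakayama lemma applies.
\<close>

lemma koszul_acyclic_tl:
  assumes N: "ring_ideal N" and L: "ring_ideal L" and hN: "homogeneous N" and hL: "homogeneous L"
    and lin: "linear_element a" "\<And>a. a \<in> set as \<Longrightarrow> linear_element a"
    and ac: "koszul_acyclic (Suc d) (a # as) N L"
  shows "koszul_acyclic d as N L"
  unfolding koszul_acyclic_def
proof (intro allI impI)
  fix i f assume i: "i < int d" and f: "cocycle as i N L f"
  \<comment> \<open>The pair of \<open>0\<close> and \<open>f\<close> is a cocycle for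
    \<open>a # as\<close> in degree \<open>i + 1\<close>, still below \<open>Suc d\<close>. Its
    primitive writes \<open>f\<close> as \<open>a\<close> times a cocycle, up to a
    coboundary.\<close>
  have surj: "\<exists>w g. cocycle as i N L w \<and> g \<in> cochains (length as) (i - 1) N \<and>
      (\<forall>b. f b - (a * w b - koszul as g b) \<in> L)" if f: "cocycle as i N L f" for f
  proof -
    have "koszul as f b \<in> L" for b using f by (simp add: cocycle_def)
    then have "cocycle (a # as) (i + 1) N L (join (\<lambda>b. 0) f)"
      using f by (auto simp: cocycle_Cons ideal_zero[OF L] ideal_zero[OF N] intro: ideal_uminus[OF L])
        (auto simp: cocycle_def cochains_zero[OF N] ideal_zero[OF L])
    then obtain v where v: "v \<in> cochains (Suc (length as)) i N"
      "\<And>b. join (\<lambda>b. 0) f b - koszul (a # as) v b \<in> L"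
      using koszul_acyclicD[OF ac, of "i + 1"] i unfolding coboundary_def by auto
    have "koszul as (\<lambda>b. v (False # b)) b \<in> L" for b
      using ideal_uminus[OF L v(2)[of "False # b"]] by simp
    then have "cocycle as i N L (\<lambda>b. v (False # b))"
      using v(1) by (simp add: cocycle_def cochains_Suc)
    moreover have "(\<lambda>b. v (True # b)) \<in> cochains (length as) (i - 1) N"
      using v(1) by (simp add: cochains_Suc)
    moreover have "f b - (a * v (False # b) - koszul as (\<lambda>b. v (True # b)) b) \<in> L" for b
      using v(2)[of "True # b"] by simp
    ultimately show ?thesis by blast
  qed
  \<comment> \<open>Induction on the internal degree: a multiple of \<open>a\<close> has no part in
    degree \<open>0\<close>, and in degree \<open>Suc e\<close> its cofactor may be taken in degree
    \<open>e\<close>.\<close>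
  have homog: "coboundary as i N L f" if "cocycle as i N L f" "\<And>b. comp e (f b) = f b" for e f
    using that
  proof (induction e arbitrary: f)
    case 0
    obtain w g where wg: "\<And>b. f b - (a * w b - koszul as g b) \<in> L"
      using surj[OF 0(1)] by blast
    have "comp 0 (f b - (a * w b - koszul as g b)) = f b" for b
      using 0(2) comp_koszul(2)[OF lin(2)] lin(1) by (simp add: comp_diff linear_element_def)
    then have "f b \<in> L" for b using wg[of b] hL unfolding homogeneous_def by metis
    then show ?case by (rule coboundary_zero[OF N])
  next
    case (Suc e)
    obtain w g where w: "cocycle as i N L w" and g: "g \<in> cochains (length as) (i - 1) N"
      and wg: "\<And>b. f b - (a * w b - koszul as g b) \<in> L"
      using surj[OF Suc(2)] by blast
    define w' g' where "w' = (\<lambda>b. comp e (w b))" and "g' = (\<lambda>b. - comp e (g b))"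
    have neg: "koszul as g' b = - koszul as (\<lambda>b. comp e (g b)) b" for b
      using koszul_mult[of as "-1" "\<lambda>b. comp e (g b)" b] by (simp add: g'_def)
    have "comp (Suc e) (f b - (a * w b - koszul as g b)) = f b - (a * w' b + koszul as g' b)" for b
      using Suc.prems(2) comp_koszul(1)[OF lin(2)] lin(1)
      by (simp add: comp_diff linear_element_def w'_def neg)
    then have *: "f b - (a * w' b + koszul as g' b) \<in> L" for b
      using wg[of b] hL unfolding homogeneous_def by metis
    have "koszul as w' b \<in> L" for b
      using comp_koszul(1)[OF lin(2), of as e w b] w hL
      unfolding w'_def cocycle_def homogeneous_def by metis
    then have "cocycle as i N L w'"
      using w comp_in_cochains[OF hN] by (simp add: cocycle_def w'_def)
    then have "coboundary as i N L w'"
      by (rule Suc.IH) (simp add: w'_def comp_comp)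
    then have "coboundary as i N L (\<lambda>b. a * w' b)" by (rule coboundary_mult[OF N L])
    moreover have "coboundary as i N L (\<lambda>b. f b - a * w' b)"
      unfolding coboundary_def
    proof (intro bexI allI)
      show "g' \<in> cochains (length as) (i - 1) N"
        unfolding g'_def by (intro cochains_uminus[OF N] comp_in_cochains[OF hN] g)
      show "f b - a * w' b - koszul as g' b \<in> L" for b
        using *[of b] by (simp add: algebra_simps)
    qed
    ultimately show ?case using coboundary_add[OF N L] by force
  qed
  obtain M where M: "\<And>x m. M x \<le> m \<Longrightarrow> (\<Sum>e<m. comp e x) = x" using comp_exhaust by metis
  \<comment> \<open>One bound for the finitely many lists where \<open>f\<close> can be nonzero, so
    that \<open>f\<close> is a finite sum of homogeneous cochains.\<close>
  define m where "m = (\<Sum>b | length b = length as. M (f b))"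
  have fin: "finite {b :: bool list. length b = length as}"
    using finite_lists_length_eq[of "UNIV :: bool set" "length as"] by simp
  have "f b = (\<Sum>e<m. comp e (f b))" for b
  proof (cases "length b = length as")
    case True
    then have "M (f b) \<le> m"
      unfolding m_def by (intro member_le_sum[OF _ _ fin]) auto
    then show ?thesis by (simp add: M)
  next
    case False
    then have "f b = 0" using f by (auto simp: cocycle_def cochains_def)
    then show ?thesis by simp
  qed
  then have "f = (\<lambda>b. \<Sum>e<m. comp e (f b))" by blast
  moreover have "coboundary as i N L (\<lambda>b. comp e (f b))" for e
  proof (rule homog[where e = e])
    have "koszul as (\<lambda>b. comp e (f b)) b \<in> L" for b
      using comp_koszul(1)[OF lin(2), of as e f b] f hL
      unfolding cocycle_def homogeneous_def by metis
    then show "cocycle as i N L (\<lambda>b. comp e (f b))"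
      using f comp_in_cochains[OF hN] by (simp add: cocycle_def)
  qed (simp add: comp_comp)
  ultimately show "coboundary as i N L f"
    using coboundary_sum[OF N L, of "{..<m}" as i "\<lambda>e b. comp e (f b)"] by simp
qed

end

section \<open>Dimension counting\<close>

context vector_space
begin

text \<open>By convention \<open>dim\<close> is \<open>0\<close> for a set without finite basis, so
  monotonicity asks for a finite spanning set.\<close>

lemma dim_mono_finite_span:
  assumes "S \<subseteq> T" "T \<subseteq> span W" "finite W"
  shows "dim S \<le> dim T"
proof -
  obtain A where A: "A \<subseteq> S" "independent A" "S \<subseteq> span A" "card A = dim S" using basis_exists .
  obtain B where B: "B \<subseteq> T" "independent B" "T \<subseteq> span B" "card B = dim T" using basis_exists .
  have "finite B" using independent_span_bound[OF assms(3) B(2)] B(1) assms(2) by blast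
  moreover have "A \<subseteq> span B" using A(1) assms(1) B(3) by blast
  ultimately have "card A \<le> card B" using independent_span_bound A(2) by blast
  then show ?thesis using A B by simp
qed

text \<open>Rank and nullity for the map induced by \<open>f\<close> from \<open>A\<close> into the
  quotient space by \<open>Q\<close>, stated without quotient spaces.\<close>

lemma dim_sum_image:
  assumes A: "subspace A" "A \<subseteq> span W" and Q: "subspace Q" "Q \<subseteq> span W" and W: "finite W"
    and f: "Vector_Spaces.linear scale scale f"
  shows "dim {q + f x | q x. q \<in> Q \<and> x \<in> A} + dim {x \<in> A. f x \<in> Q} = dim Q + dim A"
proof -
  interpret f: Vector_Spaces.linear scale scale f by (rule f)
  define K where "K = {x \<in> A. f x \<in> Q}"
  have K: "subspace K"
    using A(1) Q(1) unfolding K_def subspace_def by (simp add: f.add f.scale f.zero)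
  obtain E where E: "E \<subseteq> Q" "independent E" "Q \<subseteq> span E" "card E = dim Q" using basis_exists .
  obtain B where B: "B \<subseteq> K" "independent B" "K \<subseteq> span B" "card B = dim K" using basis_exists .
  have "B \<subseteq> A" using B(1) by (auto simp: K_def)
  then obtain B' where B': "B \<subseteq> B'" "B' \<subseteq> A" "independent B'" "A \<subseteq> span B'"
    using maximal_independent_subset_extend[of B A] B(2) by auto
  define C where "C = B' - B"
  have B'_eq: "B' = B \<union> C" using B'(1) by (auto simp: C_def)
  have finE: "finite E" and finB': "finite B'"
    using independent_span_bound[OF W] E(1,2) Q(2) B'(2,3) A(2) by blast+
  then have finC: "finite C" and finB: "finite B" unfolding B'_eq by auto
  have spanE: "span E = Q" using E(1,3) span_minimal[OF E(1) Q(1)] by blast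
  have spanB: "span B = K" using B(1,3) span_minimal[OF B(1) K] by blast
  have spanB': "span B' = A" using B'(2,4) span_minimal[OF B'(2) A(1)] by blast
  \<comment> \<open>\<open>C\<close> completes a basis of the kernel to a basis of \<open>A\<close>.
    A dependence of its image modulo \<open>Q\<close> would put a vector involving \<open>c\<close>
    into the kernel, contradicting independence of \<open>B'\<close>.\<close>
  have "independent (E \<union> f ` D) \<and> card (E \<union> f ` D) = card E + card D" if "D \<subseteq> C" for D
    using finite_subset[OF that finC] that
  proof (induction D rule: finite_induct)
    case empty
    then show ?case using E(2) by simp
  next
    case (insert c D)
    have "f c \<notin> span (E \<union> f ` D)"
    proof
      assume "f c \<in> span (E \<union> f ` D)"
      then obtain q z where fc: "f c = q + z" and q: "q \<in> span E" and z: "z \<in> span (f ` D)"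
        unfolding span_Un by auto
      obtain y where y: "y \<in> span D" "z = f y" using z unfolding f.span_image by blast
      have "f (c - y) \<in> Q" using fc q y by (simp add: f.diff spanE)
      moreover have "y \<in> A" "c \<in> A"
        using y(1) insert.prems span_mono[of D B'] spanB' span_base[of c B'] by (auto simp: B'_eq)
      ultimately have "c - y \<in> K" using A(1) by (simp add: K_def subspace_diff)
      then have "c - y \<in> span (B \<union> D)" using spanB span_mono[of B "B \<union> D"] by blast
      moreover have "y \<in> span (B \<union> D)" using y(1) span_mono[of D "B \<union> D"] by blast
      ultimately have "c \<in> span (B \<union> D)" using span_add[of "c - y" "B \<union> D" y] by simp
      moreover have "B \<union> D \<subseteq> B' - {c}"
        using insert.prems insert.hyps(2) B'(1) unfolding C_def by blast
      ultimately have "c \<in> span (B' - {c})" using span_mono by blast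
      moreover have "c \<in> B'" using insert.prems by (auto simp: C_def)
      ultimately show False using B'(3) unfolding dependent_def by blast
    qed
    then have "f c \<notin> E \<union> f ` D" using span_base[of "f c"] by metis
    then show ?case
      using insert.IH insert.prems insert.hyps finE
        independent_insertI[OF \<open>f c \<notin> span (E \<union> f ` D)\<close>] by auto
  qed
  then have ind: "independent (E \<union> f ` C)" "card (E \<union> f ` C) = card E + card C" by auto
  have "dim {q + f x | q x. q \<in> Q \<and> x \<in> A} = card E + card C"
  proof (rule dim_unique[OF _ _ ind])
    show "E \<union> f ` C \<subseteq> {q + f x | q x. q \<in> Q \<and> x \<in> A}"
    proof safe
      fix e assume "e \<in> E"
      then show "\<exists>q x. e = q + f x \<and> q \<in> Q \<and> x \<in> A"
        using E(1) subspace_0[OF A(1)] f.zero by (intro exI[of _ e] exI[of _ 0]) auto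
    next
      fix c assume "c \<in> C"
      then show "\<exists>q x. f c = q + f x \<and> q \<in> Q \<and> x \<in> A"
        using B'(2) subspace_0[OF Q(1)] by (intro exI[of _ 0] exI[of _ c]) (auto simp: C_def)
    qed
    show "{q + f x | q x. q \<in> Q \<and> x \<in> A} \<subseteq> span (E \<union> f ` C)"
    proof safe
      fix q x assume q: "q \<in> Q" and "x \<in> A"
      then obtain b c where x: "x = b + c" "b \<in> K" "c \<in> span C"
        using spanB' unfolding B'_eq span_Un spanB by blast
      have "f b \<in> span E" "q \<in> span E" using x(2) q by (auto simp: K_def spanE)
      moreover have "f c \<in> span (f ` C)" using x(3) by (auto simp: f.span_image)
      ultimately show "q + f x \<in> span (E \<union> f ` C)"
        unfolding x(1) f.add using span_mono[of E "E \<union> f ` C"] span_mono[of "f ` C" "E \<union> f ` C"]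
        by (intro span_add) auto
    qed
  qed
  moreover have "dim A = card B + card C"
  proof -
    have "B \<inter> C = {}" unfolding C_def by blast
    then have "card B' = card B + card C"
      unfolding B'_eq by (rule card_Un_disjoint[OF finB finC])
    then show ?thesis using dim_unique[OF B'(2,4,3) refl] by simp
  qed
  ultimately show ?thesis using E(4) B(4) unfolding K_def by linarith
qed

end

section \<open>The polynomial ring\<close>

lemma poly_mapping_sum_single: "p = (\<Sum>m\<in>Poly_Mapping.keys p. Poly_Mapping.single m (Poly_Mapping.lookup p m))"
proof (rule poly_mapping_eqI)
  fix k
  have "(\<Sum>m\<in>Poly_Mapping.keys p. Poly_Mapping.lookup (Poly_Mapping.single m (Poly_Mapping.lookup p m)) k)
      = (\<Sum>m\<in>Poly_Mapping.keys p. if m = k then Poly_Mapping.lookup p k else 0)"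
    by (intro sum.cong) (auto simp: lookup_single when_def)
  then show "Poly_Mapping.lookup p k =
      Poly_Mapping.lookup (\<Sum>m\<in>Poly_Mapping.keys p. Poly_Mapping.single m (Poly_Mapping.lookup p m)) k"
    by (auto simp: lookup_sum in_keys_iff)
qed

lemma poly_mapping_single_induct:
  fixes p :: "'a \<Rightarrow>\<^sub>0 'b::comm_monoid_add"
  assumes "\<And>m c. P (Poly_Mapping.single m c)" "\<And>p q. P p \<Longrightarrow> P q \<Longrightarrow> P (p + q)"
  shows "P p"
proof -
  have "P (\<Sum>m\<in>A. Poly_Mapping.single m (Poly_Mapping.lookup p m))" for A
    using assms assms(1)[of undefined 0]
    by (induction A rule: infinite_finite_induct) auto
  then show ?thesis using poly_mapping_sum_single by metis
qed

definition total_degree :: "('v::finite \<Rightarrow>\<^sub>0 nat) \<Rightarrow> nat" where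
  "total_degree m = (\<Sum>v\<in>UNIV. Poly_Mapping.lookup m v)"

lemma total_degree_add: "total_degree (m + n) = total_degree m + total_degree n"
  by (simp add: total_degree_def lookup_add sum.distrib)

lemma total_degree_single [simp]: "total_degree (Poly_Mapping.single v n) = n"
  by (simp add: total_degree_def lookup_single when_def)

lemma finite_total_degree_eq: "finite {m :: 'v::finite \<Rightarrow>\<^sub>0 nat. total_degree m = e}"
proof (rule finite_imageD)
  have "Poly_Mapping.lookup ` {m :: 'v \<Rightarrow>\<^sub>0 nat. total_degree m = e} \<subseteq> UNIV \<rightarrow>\<^sub>E {..e}"
    by (auto simp: total_degree_def intro!: member_le_sum)
  then show "finite (Poly_Mapping.lookup ` {m :: 'v \<Rightarrow>\<^sub>0 nat. total_degree m = e})"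
    by (rule finite_subset) (intro finite_PiE finite_class.finite_UNIV finite_atMost)
qed (simp add: inj_on_def poly_mapping.lookup_inject)

definition homogeneous_part :: "nat \<Rightarrow> ('v::finite, 'k::field) mpolynomial \<Rightarrow> ('v, 'k) mpolynomial" where
  "homogeneous_part e p = Poly_Mapping.mapp (\<lambda>m c. if total_degree m = e then c else 0) p"

lemma lookup_homogeneous_part:
  "Poly_Mapping.lookup (homogeneous_part e p) m =
     (if total_degree m = e then Poly_Mapping.lookup p m else 0)"
  by (auto simp: homogeneous_part_def lookup_mapp when_def in_keys_iff)

lemma keys_homogeneous_part:
  "Poly_Mapping.keys (homogeneous_part e p) = {m \<in> Poly_Mapping.keys p. total_degree m = e}"
  by (auto simp: in_keys_iff lookup_homogeneous_part split: if_splits)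

lemma homogeneous_part_single:
  "homogeneous_part e (Poly_Mapping.single m c) = (if total_degree m = e then Poly_Mapping.single m c else 0)"
  by (rule poly_mapping_eqI) (auto simp: lookup_homogeneous_part lookup_single when_def)

interpretation polynomial: grading "homogeneous_part :: nat \<Rightarrow> ('v::finite, 'k::field) mpolynomial \<Rightarrow> _"
proof
  fix e e' and x y :: "('v, 'k) mpolynomial"
  show "homogeneous_part e (x + y) = homogeneous_part e x + homogeneous_part e y"
    by (rule poly_mapping_eqI) (simp add: lookup_homogeneous_part lookup_add)
  show "homogeneous_part e (homogeneous_part e' x) = (if e = e' then homogeneous_part e x else 0)"
    by (rule poly_mapping_eqI) (simp add: lookup_homogeneous_part)
  obtain m where m: "\<And>k. k \<in> Poly_Mapping.keys x \<Longrightarrow> total_degree k < m"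
    using finite_nat_set_iff_bounded[of "total_degree ` Poly_Mapping.keys x"] by auto
  have "(\<Sum>e<m'. homogeneous_part e x) = x" if "m' \<ge> m" for m'
  proof (rule poly_mapping_eqI)
    fix k
    have "Poly_Mapping.lookup x k = 0" if "\<not> total_degree k < m'"
      using m[of k] that \<open>m' \<ge> m\<close> by (force simp: in_keys_iff)
    then show "Poly_Mapping.lookup (\<Sum>e<m'. homogeneous_part e x) k = Poly_Mapping.lookup x k"
      by (simp add: lookup_sum lookup_homogeneous_part)
  qed
  then show "\<exists>m. \<forall>m'\<ge>m. (\<Sum>e<m'. homogeneous_part e x) = x" by blast
qed

definition linear_form :: "('v::finite \<Rightarrow> 'k::field) \<Rightarrow> ('v, 'k) mpolynomial" where
  "linear_form c = (\<Sum>v\<in>UNIV. Poly_Mapping.single 0 (c v) * variable v)"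

lemma linear_element_linear_form:
  "polynomial.linear_element (linear_form c :: ('v::finite, 'k::field) mpolynomial)"
proof -
  have "homogeneous_part (Suc e) (variable v * x) = variable v * homogeneous_part e x"
    "homogeneous_part 0 (variable v * x) = 0" for e v and x :: "('v, 'k) mpolynomial"
    by (induction x rule: poly_mapping_single_induct)
       (simp_all add: distrib_left polynomial.comp_add variable_def mult_single
          homogeneous_part_single total_degree_add)
  moreover have "homogeneous_part e (Poly_Mapping.single 0 c * x) =
      Poly_Mapping.single 0 c * homogeneous_part e x" for e c and x :: "('v, 'k) mpolynomial"
    by (induction x rule: poly_mapping_single_induct)
       (simp_all add: distrib_left polynomial.comp_add mult_single homogeneous_part_single)
  moreover have "homogeneous_part e (sum f A) = (\<Sum>x\<in>A. homogeneous_part e (f x))"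
    for e A and f :: "'v \<Rightarrow> ('v, 'k) mpolynomial"
    by (induction A rule: infinite_finite_induct) (simp_all add: polynomial.comp_add)
  ultimately show ?thesis
    by (simp add: polynomial.linear_element_def linear_form_def sum_distrib_right mult.assoc)
qed

lemma linear_element_mult:
  "polynomial.linear_element a \<Longrightarrow>
     homogeneous_part (Suc e) (a * x) = a * homogeneous_part e x"
  "polynomial.linear_element a \<Longrightarrow> homogeneous_part 0 (a * x) = 0"
  by (simp_all add: polynomial.linear_element_def)

abbreviation const :: "'k::field \<Rightarrow> ('v::finite, 'k) mpolynomial" where
  "const \<equiv> Poly_Mapping.single 0"

interpretation polynomial: vector_space "\<lambda>c (p :: ('v::finite, 'k::field) mpolynomial). const c * p"
  by unfold_locales (simp_all add: algebra_simps single_add mult_single flip: mult.assoc)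

lemma lookup_const_mult: "Poly_Mapping.lookup (const c * p) m = c * Poly_Mapping.lookup p m"
proof (induction p rule: poly_mapping_single_induct)
  case (1 m' c')
  then show ?case by (simp add: mult_single lookup_single when_def)
qed (simp add: distrib_left lookup_add)

section \<open>Hilbert functions\<close>

definition degree_part :: "nat \<Rightarrow> ('v::finite, 'k::field) mpolynomial set \<Rightarrow> ('v, 'k) mpolynomial set" where
  "degree_part e X = {p \<in> X. homogeneous_part e p = p}"

text \<open>For ideals with \<open>L \<subseteq> N\<close> this is the Hilbert function of
  \<open>N / L\<close>, taken as a difference of dimensions so that quotient spaces do not
  appear.\<close>

definition hilbert :: "('v::finite, 'k::field) mpolynomial set \<Rightarrow> ('v, 'k) mpolynomial set \<Rightarrow> nat \<Rightarrow> int" where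
  "hilbert N L e = int (polynomial.dim (degree_part e N)) - int (polynomial.dim (degree_part e L))"

definition monomials :: "nat \<Rightarrow> ('v::finite, 'k::field) mpolynomial set" where
  "monomials e = (\<lambda>m. Poly_Mapping.single m 1) ` {m. total_degree m = e}"

lemma finite_monomials: "finite (monomials e)"
  unfolding monomials_def by (intro finite_imageI finite_total_degree_eq)

lemma homogeneous_part_eq_iff:
  "homogeneous_part e p = p \<longleftrightarrow> (\<forall>m\<in>Poly_Mapping.keys p. total_degree m = e)"
  unfolding poly_mapping_eq_iff fun_eq_iff by (auto simp: lookup_homogeneous_part in_keys_iff)

lemma degree_part_span:
  "degree_part e {p :: ('v::finite, 'k::field) mpolynomial. \<forall>m\<in>Poly_Mapping.keys p. P m} \<subseteq>
    polynomial.span ((\<lambda>m. Poly_Mapping.single m 1) ` {m. P m \<and> total_degree m = e})"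
proof
  fix p :: "('v, 'k) mpolynomial"
  assume p: "p \<in> degree_part e {p. \<forall>m\<in>Poly_Mapping.keys p. P m}"
  let ?B = "(\<lambda>m. Poly_Mapping.single m 1) ` {m. P m \<and> total_degree m = e}"
  have "(\<Sum>m\<in>Poly_Mapping.keys p. const (Poly_Mapping.lookup p m) * Poly_Mapping.single m 1)
      \<in> polynomial.span ?B"
    using p by (intro polynomial.span_sum polynomial.span_scale polynomial.span_base)
      (auto simp: degree_part_def homogeneous_part_eq_iff)
  then show "p \<in> polynomial.span ?B"
    by (simp add: mult_single flip: poly_mapping_sum_single)
qed

lemma degree_part_subset_span: "degree_part e X \<subseteq> polynomial.span (monomials e)"
  using degree_part_span[of e "\<lambda>_. True"] by (auto simp: degree_part_def monomials_def)

lemma dim_degree_part: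
  "polynomial.dim (degree_part e {p :: ('v::finite, 'k::field) mpolynomial. \<forall>m\<in>Poly_Mapping.keys p. P m}) =
     card {m. P m \<and> total_degree m = e}"
proof (rule polynomial.dim_unique[OF _ degree_part_span])
  let ?S = "{m. P m \<and> total_degree m = e}"
  let ?b = "\<lambda>m. Poly_Mapping.single m 1 :: ('v, 'k) mpolynomial"
  have inj: "inj_on ?b ?S"
    by (rule inj_onI) (metis lookup_single_eq lookup_single_not_eq one_neq_zero)
  then show "card (?b ` ?S) = card ?S" by (rule card_image)
  show "?b ` ?S \<subseteq> degree_part e {p. \<forall>m\<in>Poly_Mapping.keys p. P m}"
    by (auto simp: degree_part_def homogeneous_part_single)
  have fin: "finite ?S" by (rule finite_subset[OF _ finite_total_degree_eq[of e]]) auto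
  show "polynomial.independent (?b ` ?S)"
  proof (rule polynomial.independent_if_scalars_zero[OF finite_imageI[OF fin]])
    fix f x assume f: "(\<Sum>x\<in>?b ` ?S. const (f x) * x) = 0" and "x \<in> ?b ` ?S"
    then obtain m where m: "m \<in> ?S" "x = ?b m" by auto
    have "0 = Poly_Mapping.lookup (\<Sum>m\<in>?S. const (f (?b m)) * ?b m) m"
      using f by (simp add: sum.reindex[OF inj])
    also have "\<dots> = (\<Sum>m'\<in>?S. if m' = m then f (?b m) else 0)"
      unfolding lookup_sum lookup_const_mult
      by (intro sum.cong) (auto simp: lookup_single when_def)
    also have "\<dots> = f x" using m fin by simp
    finally show "f x = 0" by simp
  qed
qed

lemma subspace_degree_part:
  fixes X :: "('v::finite, 'k::field) mpolynomial set"
  assumes "ring_ideal X"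
  shows "polynomial.subspace (degree_part e X)"
proof -
  have "homogeneous_part e (const c * x) = const c * homogeneous_part e x"
    for c and x :: "('v, 'k) mpolynomial"
    by (rule poly_mapping_eqI) (simp add: lookup_homogeneous_part lookup_const_mult)
  then show ?thesis
    unfolding polynomial.subspace_def degree_part_def
    by (auto simp: polynomial.comp_add intro: ideal_intros[OF assms])
qed

lemma linear_mult: "Vector_Spaces.linear (\<lambda>c (p :: ('v::finite, 'k::field) mpolynomial). const c * p)
    (\<lambda>c p. const c * p) ((*) a)"
  unfolding Vector_Spaces.linear_iff
  by (intro conjI polynomial.vector_space_axioms) (simp_all add: algebra_simps)

text \<open>Rank and nullity of multiplication by \<open>a\<close> from degree \<open>e - 1\<close>
  into degree \<open>e\<close> modulo \<open>Q\<close>: regularity makes the kernel the degree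
  \<open>e - 1\<close> part of \<open>Q\<close>. In degree \<open>0\<close> a linear element
  contributes nothing.\<close>

lemma hilbert_regular:
  assumes N: "ring_ideal N" and Q: "ring_ideal Q" and QN: "Q \<subseteq> N"
    and hN: "polynomial.homogeneous N" and hQ: "polynomial.homogeneous Q"
    and a: "polynomial.linear_element a" and reg: "\<And>x. x \<in> N \<Longrightarrow> a * x \<in> Q \<Longrightarrow> x \<in> Q"
  shows "hilbert N {y + a * x | x y. x \<in> N \<and> y \<in> Q} e =
    hilbert N Q e - (if e = 0 then 0 else hilbert N Q (e - 1))"
proof (cases e)
  case 0
  have "degree_part 0 {y + a * x | x y. x \<in> N \<and> y \<in> Q} = degree_part 0 Q"
  proof
    show "degree_part 0 {y + a * x | x y. x \<in> N \<and> y \<in> Q} \<subseteq> degree_part 0 Q"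
    proof
      fix p assume "p \<in> degree_part 0 {y + a * x | x y. x \<in> N \<and> y \<in> Q}"
      then obtain x y where p: "homogeneous_part 0 p = p" "p = y + a * x" "y \<in> Q"
        by (auto simp: degree_part_def)
      then have "p = homogeneous_part 0 y"
        using linear_element_mult[OF a] by (metis add.right_neutral polynomial.comp_add)
      then show "p \<in> degree_part 0 Q"
        using p(1,3) hQ by (auto simp: degree_part_def polynomial.homogeneous_def)
    qed
    show "degree_part 0 Q \<subseteq> degree_part 0 {y + a * x | x y. x \<in> N \<and> y \<in> Q}"
      using ideal_zero[OF N] by (force simp: degree_part_def)
  qed
  then show ?thesis by (simp add: hilbert_def 0)
next
  case (Suc n)
  have 1: "degree_part e {y + a * x | x y. x \<in> N \<and> y \<in> Q} =
      {q + a * x | q x. q \<in> degree_part e Q \<and> x \<in> degree_part n N}"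
  proof
    show "degree_part e {y + a * x | x y. x \<in> N \<and> y \<in> Q} \<subseteq>
      {q + a * x | q x. q \<in> degree_part e Q \<and> x \<in> degree_part n N}"
    proof
      fix p assume "p \<in> degree_part e {y + a * x | x y. x \<in> N \<and> y \<in> Q}"
      then obtain x y where p: "homogeneous_part e p = p" "p = y + a * x" and xy: "x \<in> N" "y \<in> Q"
        by (auto simp: degree_part_def)
      then have "p = homogeneous_part e y + a * homogeneous_part n x"
        using linear_element_mult[OF a] by (metis polynomial.comp_add Suc)
      moreover have "homogeneous_part e y \<in> degree_part e Q" "homogeneous_part n x \<in> degree_part n N"
        using xy hQ hN by (auto simp: degree_part_def polynomial.homogeneous_def polynomial.comp_comp)
      ultimately show "p \<in> {q + a * x | q x. q \<in> degree_part e Q \<and> x \<in> degree_part n N}" by blast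
    qed
    show "{q + a * x | q x. q \<in> degree_part e Q \<and> x \<in> degree_part n N} \<subseteq>
      degree_part e {y + a * x | x y. x \<in> N \<and> y \<in> Q}"
      using linear_element_mult[OF a]
      by (auto simp: degree_part_def polynomial.comp_add Suc)
  qed
  have "{x \<in> degree_part n N. a * x \<in> degree_part e Q} = degree_part n Q"
    using linear_element_mult[OF a] reg QN ideal_mult[OF Q] by (auto simp: degree_part_def Suc)
  moreover have "degree_part n N \<subseteq> polynomial.span (monomials n \<union> monomials e)"
    "degree_part e Q \<subseteq> polynomial.span (monomials n \<union> monomials e)"
    using degree_part_subset_span polynomial.span_mono[of _ "monomials n \<union> monomials e"]
    by blast+
  ultimately show ?thesis
    using polynomial.dim_sum_image[OF subspace_degree_part[OF N] _ subspace_degree_part[OF Q] _ _ linear_mult,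
        of n "monomials n \<union> monomials e" e a]
    unfolding hilbert_def 1 by (simp add: Suc finite_monomials)
qed

text \<open>Acyclicity passes to the tail with the bound lowered by one, so every entry is regular
  modulo the entries after it. Each such entry multiplies the Hilbert series by
  \<open>1 - fps_X\<close>.\<close>

lemma hilbert_adjoin:
  assumes N: "ring_ideal N" and L: "ring_ideal L" and LN: "L \<subseteq> N"
    and hN: "polynomial.homogeneous N" and hL: "polynomial.homogeneous L"
    and lin: "\<And>a. a \<in> set as \<Longrightarrow> polynomial.linear_element a"
    and ac: "koszul_acyclic (length as) as N L"
  shows "Abs_fps (hilbert N (adjoin as N L)) = (1 - fps_X) ^ length as * Abs_fps (hilbert N L)"
  using lin ac
proof (induction as)
  case (Cons a as)
  have ac: "koszul_acyclic (length as) as N L"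
    using polynomial.koszul_acyclic_tl[OF N L hN hL, of a as "length as"] Cons.prems by auto
  have Q: "ring_ideal (adjoin as N L)" "adjoin as N L \<subseteq> N" "polynomial.homogeneous (adjoin as N L)"
    using ring_ideal_adjoin[OF N L] adjoin_subset[OF N LN]
      polynomial.homogeneous_adjoin[OF N L hN hL] Cons.prems(1) by simp_all
  have "hilbert N (adjoin (a # as) N L) e = hilbert N (adjoin as N L) e -
      (if e = 0 then 0 else hilbert N (adjoin as N L) (e - 1))" for e
    using hilbert_regular[OF N Q(1,2) hN Q(3), of a e] regular_of_koszul_acyclic[OF N L, of as a] Cons.prems
    by simp
  then have "Abs_fps (hilbert N (adjoin (a # as) N L)) =
      (1 - fps_X) * Abs_fps (hilbert N (adjoin as N L))"
    by (intro fps_ext) (simp add: left_diff_distrib)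
  then show ?case using Cons.IH[OF _ ac] Cons.prems(1) by (simp add: mult.assoc)
qed simp

text \<open>\<open>N / P\<close> maps onto \<open>N / (N \<inter> Q)\<close>, which is isomorphic to
  \<open>(N + Q) / Q\<close>.\<close>

lemma hilbert_mono:
  assumes N: "ring_ideal N" and hN: "polynomial.homogeneous N" and Q: "ring_ideal Q"
    and hQ: "polynomial.homogeneous Q"
    and P: "P \<subseteq> N \<inter> Q" and N': "N' = {q + x | q x. q \<in> Q \<and> x \<in> N}"
  shows "hilbert N' Q e \<le> hilbert N P e"
proof -
  \<comment> \<open>The factor \<open>1\<close> matches the shape of \<open>dim_sum_image\<close>,
    applied to multiplication by \<open>1\<close>.\<close>
  have N'_part: "degree_part e N' = {q + 1 * x | q x. q \<in> degree_part e Q \<and> x \<in> degree_part e N}"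
  proof
    show "degree_part e N' \<subseteq> {q + 1 * x | q x. q \<in> degree_part e Q \<and> x \<in> degree_part e N}"
    proof
      fix p assume "p \<in> degree_part e N'"
      then obtain x y where p: "homogeneous_part e p = p" "p = y + x" and xy: "x \<in> N" "y \<in> Q"
        unfolding degree_part_def N' by blast
      have "p = homogeneous_part e p" using p(1) by simp
      also have "\<dots> = homogeneous_part e y + 1 * homogeneous_part e x"
        by (simp only: p(2) polynomial.comp_add mult_1)
      finally have "p = homogeneous_part e y + 1 * homogeneous_part e x" .
      moreover have "homogeneous_part e y \<in> degree_part e Q" "homogeneous_part e x \<in> degree_part e N"
        using xy hQ hN by (auto simp: degree_part_def polynomial.homogeneous_def polynomial.comp_comp)
      ultimately show "p \<in> {q + 1 * x | q x. q \<in> degree_part e Q \<and> x \<in> degree_part e N}" by blast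
    qed
    show "{q + 1 * x | q x. q \<in> degree_part e Q \<and> x \<in> degree_part e N} \<subseteq> degree_part e N'"
      unfolding degree_part_def N' by (auto simp: polynomial.comp_add)
  qed
  have "degree_part e P \<subseteq> {x \<in> degree_part e N. 1 * x \<in> degree_part e Q}"
    using P by (auto simp: degree_part_def)
  then have "polynomial.dim (degree_part e P) \<le>
      polynomial.dim {x \<in> degree_part e N. 1 * x \<in> degree_part e Q}"
    by (rule polynomial.dim_mono_finite_span[OF _ _ finite_monomials[of e]])
       (use degree_part_subset_span in auto)
  then show ?thesis
    using polynomial.dim_sum_image[OF subspace_degree_part[OF N] degree_part_subset_span
        subspace_degree_part[OF Q] degree_part_subset_span finite_monomials linear_mult, of 1 e]
    unfolding hilbert_def N'_part by linarith
qed

section \<open>Stanley--Reisner ideals\<close>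

lemma keys_add_nat: "Poly_Mapping.keys (m + n) = Poly_Mapping.keys m \<union> Poly_Mapping.keys (n :: 'v \<Rightarrow>\<^sub>0 nat)"
  by (auto simp: in_keys_iff lookup_add)

definition squarefree_exponent :: "'v::finite set \<Rightarrow> 'v \<Rightarrow>\<^sub>0 nat" where
  "squarefree_exponent F = (\<Sum>v\<in>F. Poly_Mapping.single v 1)"

lemma lookup_squarefree_exponent:
  "Poly_Mapping.lookup (squarefree_exponent F) v = (if v \<in> F then 1 else 0)"
  by (auto simp: squarefree_exponent_def lookup_sum lookup_single when_def)

lemma keys_squarefree_exponent [simp]: "Poly_Mapping.keys (squarefree_exponent F) = F"
  by (auto simp: in_keys_iff lookup_squarefree_exponent split: if_splits)

lemma prod_variable: "(\<Prod>v\<in>F. variable v) = Poly_Mapping.single (squarefree_exponent F) 1"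
  using finite[of F] unfolding squarefree_exponent_def
  by (induction F rule: finite_induct) (simp_all add: variable_def mult_single)

text \<open>For a simplicial complex this is the Stanley-Reisner ideal, in a form where membership
  is read off monomial by monomial.\<close>

definition nonface_polynomials :: "'v::finite set set \<Rightarrow> ('v, 'k::field) mpolynomial set" where
  "nonface_polynomials \<Delta> = {p. \<forall>m\<in>Poly_Mapping.keys p. Poly_Mapping.keys m \<notin> \<Delta>}"

lemma ring_ideal_nonface_polynomials:
  assumes "simplicial_complex \<Delta>"
  shows "ring_ideal (nonface_polynomials \<Delta> :: ('v::finite, 'k::field) mpolynomial set)"
  unfolding ring_ideal_iff
proof (intro conjI ballI allI)
  fix x y :: "('v, 'k) mpolynomial"
  assume "x \<in> nonface_polynomials \<Delta>" "y \<in> nonface_polynomials \<Delta>"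
  then show "x + y \<in> nonface_polynomials \<Delta>"
    using Poly_Mapping.keys_add[of x y] by (auto simp: nonface_polynomials_def)
next
  fix c x :: "('v, 'k) mpolynomial"
  assume x: "x \<in> nonface_polynomials \<Delta>"
  have "Poly_Mapping.keys m \<notin> \<Delta>" if m: "m \<in> Poly_Mapping.keys (c * x)" for m
  proof -
    obtain a b where "m = a + b" "b \<in> Poly_Mapping.keys x"
      using subsetD[OF Poly_Mapping.keys_mult m] by auto
    then have "Poly_Mapping.keys b \<subseteq> Poly_Mapping.keys m" "Poly_Mapping.keys b \<notin> \<Delta>"
      using x by (simp_all add: keys_add_nat nonface_polynomials_def)
    then show ?thesis using assms unfolding simplicial_complex_def by blast
  qed
  then show "c * x \<in> nonface_polynomials \<Delta>" by (simp add: nonface_polynomials_def)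
qed (simp add: nonface_polynomials_def)

lemma stanley_reisner_ideal_eq:
  assumes "simplicial_complex \<Delta>"
  shows "stanley_reisner_ideal \<Delta> = (nonface_polynomials \<Delta> :: ('v::finite, 'k::field) mpolynomial set)"
    (is "?I = ?N")
proof
  show "?I \<subseteq> ?N"
    unfolding stanley_reisner_ideal_def
    by (rule ideal_gen_least[OF _ ring_ideal_nonface_polynomials[OF assms]])
       (auto simp: prod_variable nonface_polynomials_def)
  show "?N \<subseteq> ?I"
  proof
    fix p :: "('v, 'k) mpolynomial" assume p: "p \<in> nonface_polynomials \<Delta>"
    have "Poly_Mapping.single m c \<in> stanley_reisner_ideal \<Delta>"
      if "Poly_Mapping.keys m \<notin> \<Delta>" for m and c :: 'k
    proof -
      let ?F = "Poly_Mapping.keys m"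
      have "(\<Prod>v\<in>?F. variable v) \<in> stanley_reisner_ideal \<Delta>"
        unfolding stanley_reisner_ideal_def using that by (intro ideal_gen_superset[THEN subsetD]) blast
      then have "Poly_Mapping.single (m - squarefree_exponent ?F) c * (\<Prod>v\<in>?F. variable v)
          \<in> stanley_reisner_ideal \<Delta>"
        unfolding stanley_reisner_ideal_def by (rule ideal_mult[OF ring_ideal_ideal_gen])
      \<comment> \<open>Subtraction of exponents truncates, but every vertex of \<open>?F\<close>
        has a positive exponent in \<open>m\<close>.\<close>
      moreover have "m - squarefree_exponent ?F + squarefree_exponent ?F = m"
        by (rule poly_mapping_eqI)
          (auto simp: lookup_add lookup_minus lookup_squarefree_exponent in_keys_iff)
      ultimately show ?thesis by (simp add: prod_variable mult_single)
    qed
    then have "(\<Sum>m\<in>Poly_Mapping.keys p. Poly_Mapping.single m (Poly_Mapping.lookup p m))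
        \<in> stanley_reisner_ideal \<Delta>"
      using p unfolding stanley_reisner_ideal_def nonface_polynomials_def
      by (intro ideal_sum ring_ideal_ideal_gen) blast
    then show "p \<in> stanley_reisner_ideal \<Delta>" by (simp flip: poly_mapping_sum_single)
  qed
qed

lemma homogeneous_nonface_polynomials: "polynomial.homogeneous (nonface_polynomials \<Delta>)"
  by (auto simp: polynomial.homogeneous_def nonface_polynomials_def keys_homogeneous_part)

lemma nonface_polynomials_mono: "\<Gamma> \<subseteq> \<Delta> \<Longrightarrow> nonface_polynomials \<Delta> \<subseteq> nonface_polynomials \<Gamma>"
  by (auto simp: nonface_polynomials_def)

lemma lookup_mult_single:
  fixes r :: "('v::finite, 'k::field) mpolynomial"
  shows "Poly_Mapping.lookup (r * Poly_Mapping.single k 1) (m + k) = Poly_Mapping.lookup r m"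
  by (induction r rule: poly_mapping_single_induct)
     (auto simp: mult_single lookup_single when_def distrib_right lookup_add)

text \<open>A product monomial surviving modulo the ideal of \<open>\<Delta>\<close> would have as
  support a face of \<open>\<Delta>\<close> that contains \<open>G\<close> and,
  \<open>\<Gamma>\<close> being closed under subsets, is not in \<open>\<Gamma>\<close>.\<close>

lemma nonface_monomial_annihilates:
  assumes \<Gamma>: "simplicial_complex \<Gamma>" and \<Delta>: "simplicial_complex \<Delta>"
    and G: "\<nexists>F. F \<in> \<Delta> - \<Gamma> \<and> G \<subseteq> F"
  shows "(\<Prod>v\<in>G. variable v) \<in>
    annihilator (nonface_polynomials \<Gamma>) (nonface_polynomials \<Delta> :: ('v::finite, 'k::field) mpolynomial set)"
  unfolding annihilator_def mem_Collect_eq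
proof
  fix x :: "('v, 'k) mpolynomial" assume x: "x \<in> nonface_polynomials \<Gamma>"
  have "Poly_Mapping.keys m \<notin> \<Delta>" if m: "m \<in> Poly_Mapping.keys ((\<Prod>v\<in>G. variable v) * x)" for m
  proof
    assume "Poly_Mapping.keys m \<in> \<Delta>"
    obtain a where a: "m = squarefree_exponent G + a" "a \<in> Poly_Mapping.keys x"
      using Poly_Mapping.keys_mult[of "\<Prod>v\<in>G. variable v" x] m by (auto simp: prod_variable)
    then have "Poly_Mapping.keys a \<notin> \<Gamma>" "Poly_Mapping.keys a \<subseteq> Poly_Mapping.keys m"
      "G \<subseteq> Poly_Mapping.keys m"
      using x by (auto simp: nonface_polynomials_def keys_add_nat)
    then show False
      using G \<Gamma> \<open>Poly_Mapping.keys m \<in> \<Delta>\<close> unfolding simplicial_complex_def by blast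
  qed
  then show "(\<Prod>v\<in>G. variable v) * x \<in> nonface_polynomials \<Delta>" by (simp add: nonface_polynomials_def)
qed

section \<open>Linear systems of parameters\<close>

definition ideal_radical :: "'a::comm_ring_1 set \<Rightarrow> 'a set" where
  "ideal_radical J = {a. \<exists>n. a ^ n \<in> J}"

lemma ring_ideal_radical:
  assumes J: "ring_ideal J"
  shows "ring_ideal (ideal_radical J)"
  unfolding ring_ideal_iff
proof (intro conjI ballI allI)
  show "0 \<in> ideal_radical J" using ideal_zero[OF J] by (auto simp: ideal_radical_def intro!: exI[of _ 1])
next
  fix x y assume "x \<in> ideal_radical J" "y \<in> ideal_radical J"
  then obtain m n where mn: "x ^ m \<in> J" "y ^ n \<in> J" by (auto simp: ideal_radical_def)
  have "of_nat (m + n choose k) * x ^ k * y ^ (m + n - k) \<in> J" for k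
  proof (cases "k \<ge> m")
    case True
    then have "x ^ k = x ^ (k - m) * x ^ m" by (simp flip: power_add)
    then have "x ^ k \<in> J" using ideal_mult[OF J mn(1)] by simp
    then show ?thesis by (intro ideal_mult_right[OF J] ideal_mult[OF J])
  next
    case False
    then have "y ^ (m + n - k) = y ^ (m - k) * y ^ n" by (simp flip: power_add)
    then have "y ^ (m + n - k) \<in> J" using ideal_mult[OF J mn(2)] by simp
    then show ?thesis by (rule ideal_mult[OF J])
  qed
  then have "(x + y) ^ (m + n) \<in> J" unfolding binomial_ring by (intro ideal_sum J)
  then show "x + y \<in> ideal_radical J" unfolding ideal_radical_def by blast
next
  fix c x assume "x \<in> ideal_radical J"
  then show "c * x \<in> ideal_radical J"
    by (auto simp: ideal_radical_def power_mult_distrib intro: ideal_mult[OF J])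
qed

lemma linear_form_cong_split:
  assumes "w \<in> F" "\<And>v. v \<in> F \<Longrightarrow> c v = (if v = w then 1 else 0)"
  shows "linear_form c = variable w + (\<Sum>v\<in>- F. const (c v) * variable v)"
proof -
  have "(\<Sum>v\<in>F. const (c v) * variable v) = (\<Sum>v\<in>F. if v = w then variable w else 0)"
    using assms(2) by (intro sum.cong) auto
  also have "\<dots> = variable w" using assms(1) by simp
  finally have "(\<Sum>v\<in>F. const (c v) * variable v) = variable w" .
  moreover have "(UNIV :: 'a set) = F \<union> - F" by auto
  ultimately show ?thesis
    unfolding linear_form_def using sum.union_disjoint[of F "- F"] by (metis Compl_disjoint finite)
qed

text \<open>
  Descending induction on \<open>F\<close>: on a face \<open>F\<close> some \<open>\<theta> \<in> S\<close> restricts to a single variable \<open>w\<close>, which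
  expresses \<open>x\<^sub>F x\<^sub>w\<close>, a divisor of \<open>x\<^sub>F\<^sup>2\<close>, by the monomials \<open>x\<^sub>F x\<^sub>v\<close> with \<open>v \<notin> F\<close>.
\<close>

lemma prod_variable_in_radical:
  fixes J :: "('v::finite, 'k::field) mpolynomial set"
  assumes J: "ring_ideal J" and S: "\<And>\<theta>. \<theta> \<in> S \<Longrightarrow> linear_form \<theta> \<in> J"
    and face: "\<And>F w. F \<in> \<Delta> \<Longrightarrow> w \<in> F \<Longrightarrow> \<exists>\<theta>\<in>S. \<forall>v\<in>F. \<theta> v = (if v = w then 1 else 0)"
    and nonface: "\<And>G. G \<notin> \<Delta> \<Longrightarrow> (\<Prod>v\<in>G. variable v) \<in> J"
    and "F \<noteq> {}"
  shows "(\<Prod>v\<in>F. variable v) \<in> ideal_radical J"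
  using \<open>F \<noteq> {}\<close>
proof (induction "card (- F)" arbitrary: F rule: less_induct)
  case less
  note R = ring_ideal_radical[OF J]
  have JR: "J \<subseteq> ideal_radical J" unfolding ideal_radical_def by (auto intro: exI[of _ 1])
  show ?case
  proof (cases "F \<in> \<Delta>")
    case False
    then show ?thesis using nonface JR by blast
  next
    case True
    obtain w where w: "w \<in> F" using less.prems by auto
    obtain \<theta> where \<theta>: "\<theta> \<in> S" "\<And>v. v \<in> F \<Longrightarrow> \<theta> v = (if v = w then 1 else 0)"
      using face[OF True w] by blast
    define xF where "xF = (\<Prod>v\<in>F. variable v :: ('v, 'k) mpolynomial)"
    have "xF * variable v \<in> ideal_radical J" if "v \<notin> F" for v
    proof -
      have "card (- insert v F) < card (- F)" using that by (intro psubset_card_mono) auto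
      then have "(\<Prod>v\<in>insert v F. variable v) \<in> ideal_radical J" by (intro less.hyps) auto
      then show ?thesis using that by (simp add: xF_def mult.commute)
    qed
    then have "(\<Sum>v\<in>- F. const (\<theta> v) * (xF * variable v)) \<in> ideal_radical J"
      by (intro ideal_sum[OF R] ideal_mult[OF R, of "xF * _"]) auto
    moreover have "xF * linear_form \<theta> \<in> ideal_radical J"
      using S[OF \<theta>(1)] JR by (intro ideal_mult[OF R]) auto
    moreover have "xF * variable w = xF * linear_form \<theta> - (\<Sum>v\<in>- F. const (\<theta> v) * (xF * variable v))"
    proof -
      have "linear_form \<theta> = variable w + (\<Sum>v\<in>- F. const (\<theta> v) * variable v)"
        by (rule linear_form_cong_split[OF w \<theta>(2)])
      then show ?thesis by (simp add: distrib_left sum_distrib_left mult.left_commute)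
    qed
    ultimately have "xF * variable w \<in> ideal_radical J" using ideal_diff[OF R] by simp
    then have "xF * variable w * (\<Prod>v\<in>F - {w}. variable v) \<in> ideal_radical J"
      by (rule ideal_mult_right[OF R])
    moreover have "variable w * (\<Prod>v\<in>F - {w}. variable v) = xF"
      unfolding xF_def using w by (intro prod.remove[symmetric]) auto
    ultimately have "xF\<^sup>2 \<in> ideal_radical J" by (simp add: power2_eq_square mult.assoc)
    then show ?thesis unfolding ideal_radical_def xF_def[symmetric] by (auto simp flip: power_mult)
  qed
qed

section \<open>Linear forms in general position with respect to faces\<close>

fun fun_span :: "('v \<Rightarrow> 'k::field) list \<Rightarrow> ('v \<Rightarrow> 'k) set" where
  "fun_span [] = {\<lambda>v. 0}"
| "fun_span (\<theta> # \<theta>s) = {\<lambda>v. c * \<theta> v + f v | c f. f \<in> fun_span \<theta>s}"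

lemma fun_span_Cons_tl: "f \<in> fun_span \<theta>s \<Longrightarrow> f \<in> fun_span (\<theta> # \<theta>s)"
  by (auto intro!: exI[of _ 0] exI[of _ f])

lemma fun_span_zero: "(\<lambda>v. 0) \<in> fun_span \<theta>s"
  by (induction \<theta>s) (simp_all add: fun_span_Cons_tl del: fun_span.simps(2))

lemma fun_span_hd: "\<theta> \<in> fun_span (\<theta> # \<theta>s)"
  using fun_span_zero[of \<theta>s] by (force intro!: exI[of _ 1])

lemma fun_span_add: "f \<in> fun_span \<theta>s \<Longrightarrow> g \<in> fun_span \<theta>s \<Longrightarrow> (\<lambda>v. f v + g v) \<in> fun_span \<theta>s"
proof (induction \<theta>s arbitrary: f g)
  case (Cons \<theta> \<theta>s)
  then obtain a f' b g' where "f = (\<lambda>v. a * \<theta> v + f' v)" "g = (\<lambda>v. b * \<theta> v + g' v)"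
    "f' \<in> fun_span \<theta>s" "g' \<in> fun_span \<theta>s" by auto
  then show ?case
    using Cons.IH[of f' g']
    by (auto intro!: exI[of _ "a + b"] exI[of _ "\<lambda>v. f' v + g' v"] simp: algebra_simps)
qed simp

lemma fun_span_scale: "f \<in> fun_span \<theta>s \<Longrightarrow> (\<lambda>v. r * f v) \<in> fun_span \<theta>s"
proof (induction \<theta>s arbitrary: f)
  case (Cons \<theta> \<theta>s)
  then obtain a f' where "f = (\<lambda>v. a * \<theta> v + f' v)" "f' \<in> fun_span \<theta>s" by auto
  then show ?case
    using Cons.IH[of f']
    by (auto intro!: exI[of _ "r * a"] exI[of _ "\<lambda>v. r * f' v"] simp: algebra_simps)
qed simp

lemma fun_span_diff:
  "f \<in> fun_span \<theta>s \<Longrightarrow> g \<in> fun_span \<theta>s \<Longrightarrow> (\<lambda>v. f v - g v) \<in> fun_span \<theta>s"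
  using fun_span_add[of f \<theta>s "\<lambda>v. - 1 * g v"] fun_span_scale[of g \<theta>s "- 1"] by simp

lemma fun_span_sum:
  "(\<And>w. w \<in> A \<Longrightarrow> f w \<in> fun_span \<theta>s) \<Longrightarrow> (\<lambda>v. \<Sum>w\<in>A. f w v) \<in> fun_span \<theta>s"
  by (induction A rule: infinite_finite_induct) (simp_all add: fun_span_zero fun_span_add)

lemma linear_form_fun_span:
  assumes J: "ring_ideal J"
  shows "(\<And>\<theta>. \<theta> \<in> set \<theta>s \<Longrightarrow> linear_form \<theta> \<in> J) \<Longrightarrow> f \<in> fun_span \<theta>s \<Longrightarrow> linear_form f \<in> J"
proof (induction \<theta>s arbitrary: f)
  case Nil
  then show ?case using ideal_zero[OF J] by (simp add: linear_form_def)
next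
  case (Cons \<theta> \<theta>s)
  then obtain a f' where f: "f = (\<lambda>v. a * \<theta> v + f' v)" "f' \<in> fun_span \<theta>s" by auto
  have "linear_form f = const a * linear_form \<theta> + linear_form f'"
  proof -
    have "const (a * \<theta> v) = const a * const (\<theta> v)" for v by (simp add: mult_single)
    then show ?thesis
      unfolding f(1) linear_form_def
      by (simp add: single_add distrib_right sum.distrib sum_distrib_left mult.assoc)
  qed
  moreover have "linear_form f' \<in> J" using Cons.IH f(2) Cons.prems(1) by simp
  ultimately show ?case using Cons.prems(1) by (auto intro: ideal_intros[OF J])
qed

text \<open>The span restricts onto all functions on \<open>F\<close>. Required on every relative
  face, and with as many forms as the dimension of the module, this is the Kind-Kleinschmidt
  criterion for linear systems of parameters.\<close>

definition spans_face :: "('v \<Rightarrow> 'k::field) list \<Rightarrow> 'v set \<Rightarrow> bool" where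
  "spans_face \<theta>s F \<longleftrightarrow> (\<forall>w\<in>F. \<exists>f\<in>fun_span \<theta>s. \<forall>v\<in>F. f v = (if v = w then 1 else 0))"

lemma spans_face_Cons: "spans_face \<theta>s F \<Longrightarrow> spans_face (\<theta> # \<theta>s) F"
  unfolding spans_face_def using fun_span_Cons_tl by meson

lemma spans_face_subset: "spans_face \<theta>s F \<Longrightarrow> G \<subseteq> F \<Longrightarrow> spans_face \<theta>s G"
  unfolding spans_face_def by (meson subset_eq)

text \<open>Making \<open>s\<close> vanish on \<open>F - {u}\<close> by subtracting elements of the
  span leaves at \<open>u\<close> a value that is a linear functional \<open>l\<close> of
  \<open>s\<close>. Its nonvanishing suffices, and \<open>l u = 1\<close> shows that it is nonzero
  on forms supported at \<open>u\<close>.\<close>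

lemma spans_face_insert:
  fixes F :: "'v::finite set" and \<theta>s :: "('v \<Rightarrow> 'k::field) list"
  assumes u: "u \<in> F" and sp: "spans_face \<theta>s (F - {u})"
  shows "\<exists>l :: 'v \<Rightarrow> 'k. l u = 1 \<and> (\<forall>s. (\<Sum>v\<in>UNIV. l v * s v) \<noteq> 0 \<longrightarrow> spans_face (s # \<theta>s) F)"
proof -
  obtain f where f: "\<And>w. w \<in> F - {u} \<Longrightarrow> f w \<in> fun_span \<theta>s"
    "\<And>w v. w \<in> F - {u} \<Longrightarrow> v \<in> F - {u} \<Longrightarrow> f w v = (if v = w then 1 else 0)"
    using sp unfolding spans_face_def by metis
  define l where "l v = (if v = u then 1 else if v \<in> F then - f v u else 0)" for v
  have "spans_face (s # \<theta>s) F" if c: "(\<Sum>v\<in>UNIV. l v * s v) \<noteq> 0" for s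
  proof -
    define c where "c = (\<Sum>v\<in>UNIV. l v * s v)"
    define g where "g v = s v - (\<Sum>w\<in>F - {u}. s w * f w v)" for v
    have g: "g \<in> fun_span (s # \<theta>s)"
      unfolding g_def
      by (intro fun_span_diff fun_span_hd fun_span_sum fun_span_scale fun_span_Cons_tl f)
    have g0: "g v = 0" if v: "v \<in> F - {u}" for v
    proof -
      have "(\<Sum>w\<in>F - {u}. s w * f w v) = (\<Sum>w\<in>F - {u}. if w = v then s v else 0)"
        using f(2) v by (intro sum.cong) auto
      then show ?thesis using v by (simp add: g_def)
    qed
    have "c = l u * s u + (\<Sum>v\<in>UNIV - {u}. l v * s v)"
      unfolding c_def by (rule sum.remove) auto
    also have "(\<Sum>v\<in>UNIV - {u}. l v * s v) = (\<Sum>v\<in>F - {u}. l v * s v)"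
      by (rule sum.mono_neutral_right) (auto simp: l_def)
    also have "\<dots> = (\<Sum>v\<in>F - {u}. - (s v * f v u))"
      by (intro sum.cong) (auto simp: l_def)
    finally have gu: "g u = c" by (simp add: g_def l_def sum_negf)
    define e where "e v = inverse c * g v" for v
    have e: "e \<in> fun_span (s # \<theta>s)" "e u = 1" "\<And>v. v \<in> F - {u} \<Longrightarrow> e v = 0"
      unfolding e_def using fun_span_scale[OF g] g0 gu that by (simp_all add: c_def)
    show ?thesis
      unfolding spans_face_def
    proof
      fix w assume "w \<in> F"
      show "\<exists>f\<in>fun_span (s # \<theta>s). \<forall>v\<in>F. f v = (if v = w then 1 else 0)"
      proof (cases "w = u")
        case True
        then show ?thesis using e by (intro bexI[of _ e]) auto
      next
        case False
        show ?thesis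
        proof (intro bexI ballI)
          show "(\<lambda>v. f w v - f w u * e v) \<in> fun_span (s # \<theta>s)"
            using False \<open>w \<in> F\<close>
            by (intro fun_span_diff fun_span_scale e fun_span_Cons_tl f) auto
          show "f w v - f w u * e v = (if v = w then 1 else 0)" if "v \<in> F" for v
            using f(2)[of w v] e(2) e(3)[of v] False \<open>w \<in> F\<close> that by (cases "v = u") auto
        qed
      qed
    qed
  qed
  moreover have "l u = 1" by (simp add: l_def)
  ultimately show ?thesis by blast
qed

text \<open>On the moment curve \<open>q ^ idx v\<close>, cut down to \<open>W\<close>, each
  functional becomes a polynomial in \<open>q\<close>, nonzero because distinct variables get
  distinct exponents. An infinite field has a \<open>q\<close> outside the finitely many
  roots.\<close>

lemma avoid_hyperplanes:
  fixes l :: "'i \<Rightarrow> 'v::finite \<Rightarrow> 'k::field"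
  assumes "infinite (UNIV :: 'k set)" "finite A" "\<And>i. i \<in> A \<Longrightarrow> \<exists>u\<in>W. l i u \<noteq> 0"
  shows "\<exists>s. (\<forall>v. v \<notin> W \<longrightarrow> s v = 0) \<and> (\<forall>i\<in>A. (\<Sum>v\<in>UNIV. l i v * s v) \<noteq> 0)"
proof -
  obtain idx :: "'v \<Rightarrow> nat" where idx: "inj idx"
    using finite_imp_inj_to_nat_seg[of "UNIV :: 'v set"] by auto
  define p where "p i = (\<Sum>v\<in>W. monom (l i v) (idx v))" for i
  have "p i \<noteq> 0" if i: "i \<in> A" for i
  proof -
    obtain u where u: "u \<in> W" "l i u \<noteq> 0" using assms(3)[OF i] by blast
    have "coeff (p i) (idx u) = (\<Sum>v\<in>W. if v = u then l i u else 0)"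
      unfolding p_def coeff_sum by (intro sum.cong) (auto simp: inj_eq[OF idx])
    then show ?thesis using u by auto
  qed
  then have "finite (\<Union>i\<in>A. {x. poly (p i) x = 0})"
    using assms(2) poly_roots_finite by blast
  then obtain q where q: "\<And>i. i \<in> A \<Longrightarrow> poly (p i) q \<noteq> 0"
    using ex_new_if_finite[OF assms(1)] by blast
  define s where "s v = (if v \<in> W then q ^ idx v else 0)" for v
  have "(\<Sum>v\<in>UNIV. l i v * s v) = poly (p i) q" for i
    unfolding p_def poly_sum poly_monom
    by (rule sum.mono_neutral_cong_right) (auto simp: s_def)
  then show ?thesis using q by (intro exI[of _ s]) (auto simp: s_def)
qed

lemma exists_spanning_extension:
  fixes \<theta>s :: "('v::finite \<Rightarrow> 'k::field) list"
  assumes inf: "infinite (UNIV :: 'k set)"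
    and ex: "\<And>F. F \<in> A \<Longrightarrow> \<exists>u. u \<in> F \<and> u \<in> W \<and> spans_face \<theta>s (F - {u})"
  shows "\<exists>s. (\<forall>v. v \<notin> W \<longrightarrow> s v = 0) \<and> (\<forall>F\<in>A. spans_face (s # \<theta>s) F)"
proof -
  have "\<exists>l :: 'v \<Rightarrow> 'k. (\<exists>u\<in>W. l u \<noteq> 0) \<and>
      (\<forall>s. (\<Sum>v\<in>UNIV. l v * s v) \<noteq> 0 \<longrightarrow> spans_face (s # \<theta>s) F)" if "F \<in> A" for F
    using ex[OF that] spans_face_insert[of _ F \<theta>s] by (metis one_neq_zero)
  then obtain l :: "'v set \<Rightarrow> 'v \<Rightarrow> 'k" where l: "\<And>F. F \<in> A \<Longrightarrow> \<exists>u\<in>W. l F u \<noteq> 0"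
    "\<And>F s. F \<in> A \<Longrightarrow> (\<Sum>v\<in>UNIV. l F v * s v) \<noteq> 0 \<Longrightarrow> spans_face (s # \<theta>s) F"
    by metis
  have "\<exists>s. (\<forall>v. v \<notin> W \<longrightarrow> s v = 0) \<and> (\<forall>F\<in>A. (\<Sum>v\<in>UNIV. l F v * s v) \<noteq> 0)"
    by (rule avoid_hyperplanes[OF inf finite l(1)])
  then obtain s where "\<forall>v. v \<notin> W \<longrightarrow> s v = 0" "\<forall>F\<in>A. (\<Sum>v\<in>UNIV. l F v * s v) \<noteq> 0"
    by metis
  then show ?thesis using l(2) by blast
qed

text \<open>The forms are generic for all small vertex sets, independently of any complex. They thus
  serve both the faces of \<open>\<Psi>'\<close> and the largest faces of \<open>\<Psi>\<close> with
  one vertex removed.\<close>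

lemma exists_spanning_forms:
  assumes inf: "infinite (UNIV :: 'k::field set)"
  shows "\<exists>\<theta>s :: ('v::finite \<Rightarrow> 'k) list. length \<theta>s = n \<and> (\<forall>F. card F \<le> n \<longrightarrow> spans_face \<theta>s F)"
proof (induction n)
  case 0
  then show ?case by (auto simp: spans_face_def)
next
  case (Suc n)
  then obtain \<theta>s :: "('v \<Rightarrow> 'k) list" where \<theta>s: "length \<theta>s = n" "\<And>F. card F \<le> n \<Longrightarrow> spans_face \<theta>s F"
    by blast
  have "\<exists>u. u \<in> F \<and> u \<in> UNIV \<and> spans_face \<theta>s (F - {u})" if F: "F \<in> {F. card F = Suc n}" for F
  proof -
    obtain u where "u \<in> F" using F by (cases "F = {}") auto
    then show ?thesis using F \<theta>s(2)[of "F - {u}"] by auto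
  qed
  then have "\<exists>s. (\<forall>v. v \<notin> UNIV \<longrightarrow> s v = 0) \<and> (\<forall>F\<in>{F. card F = Suc n}. spans_face (s # \<theta>s) F)"
    by (rule exists_spanning_extension[OF inf])
  then obtain s where s: "\<And>F. card F = Suc n \<Longrightarrow> spans_face (s # \<theta>s) F"
    by auto
  have "spans_face (s # \<theta>s) F" if "card F \<le> Suc n" for F
    using s[of F] \<theta>s(2)[of F] spans_face_Cons[of \<theta>s F s] that by (cases "card F = Suc n") auto
  then show ?case using \<theta>s(1) by (intro exI[of _ "s # \<theta>s"]) auto
qed

section \<open>Krull dimension and depth of face modules\<close>

text \<open>The ideal generated by the variables outside \<open>F\<close>, in terms of monomials:
  the ideal of a coordinate subspace.\<close>

definition face_prime :: "'v::finite set \<Rightarrow> ('v, 'k::field) mpolynomial set" where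
  "face_prime F = {p. \<forall>m\<in>Poly_Mapping.keys p. \<not> Poly_Mapping.keys m \<subseteq> F}"

lemma lookup_mult_sum:
  fixes p q :: "'a::comm_monoid_add \<Rightarrow>\<^sub>0 'k::comm_semiring_0"
  shows "Poly_Mapping.lookup (p * q) k = (\<Sum>(m, n) \<in> Poly_Mapping.keys p \<times> Poly_Mapping.keys q.
    if m + n = k then Poly_Mapping.lookup p m * Poly_Mapping.lookup q n else 0)"
proof -
  have "p * q = (\<Sum>m\<in>Poly_Mapping.keys p. Poly_Mapping.single m (Poly_Mapping.lookup p m)) *
      (\<Sum>n\<in>Poly_Mapping.keys q. Poly_Mapping.single n (Poly_Mapping.lookup q n))"
    by (simp flip: poly_mapping_sum_single)
  then show ?thesis
    by (auto simp: sum_product mult_single lookup_sum lookup_single when_def sum.cartesian_product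
        intro!: sum.cong)
qed

text \<open>The vertex type carries no order, so a monomial order is borrowed from the variables \<^typ>\<open>nat\<close>.\<close>

lemma exists_monomial_order:
  "\<exists>g :: ('v::finite \<Rightarrow>\<^sub>0 nat) \<Rightarrow> (nat \<Rightarrow>\<^sub>0 nat). inj g \<and> (\<forall>m n. g (m + n) = g m + g n)"
proof -
  obtain idx :: "'v \<Rightarrow> nat" where idx: "inj idx"
    using finite_imp_inj_to_nat_seg[of "UNIV :: 'v set"] by auto
  define g :: "('v \<Rightarrow>\<^sub>0 nat) \<Rightarrow> (nat \<Rightarrow>\<^sub>0 nat)"
    where "g m = (\<Sum>v\<in>UNIV. Poly_Mapping.single (idx v) (Poly_Mapping.lookup m v))" for m
  have "Poly_Mapping.lookup (g m) (idx w) = Poly_Mapping.lookup m w" for m w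
    by (simp add: g_def lookup_sum lookup_single when_def inj_eq[OF idx])
  then have "inj g" by (intro injI poly_mapping_eqI) metis
  moreover have "g (m + n) = g m + g n" for m n
    by (simp add: g_def lookup_add single_add sum.distrib)
  ultimately show ?thesis by blast
qed

text \<open>Among the monomials supported in \<open>F\<close>, the leading ones of the two factors
  have a product that arises in only one way, hence does not cancel.\<close>

lemma prime_ideal_face_prime: "prime_ideal (face_prime F :: ('v::finite, 'k::field) mpolynomial set)"
  unfolding prime_ideal_def
proof (intro conjI allI impI)
  have "face_prime F = (nonface_polynomials {G. G \<subseteq> F} :: ('v, 'k) mpolynomial set)"
    by (simp add: face_prime_def nonface_polynomials_def)
  moreover have "simplicial_complex {G. G \<subseteq> F}" by (auto simp: simplicial_complex_def)
  ultimately show "ring_ideal (face_prime F :: ('v, 'k) mpolynomial set)"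
    by (simp add: ring_ideal_nonface_polynomials)
  have "(1 :: ('v, 'k) mpolynomial) \<notin> face_prime F" by (simp add: face_prime_def)
  then show "face_prime F \<noteq> (UNIV :: ('v, 'k) mpolynomial set)" by blast
  fix p q :: "('v, 'k) mpolynomial" assume pq: "p * q \<in> face_prime F"
  show "p \<in> face_prime F \<or> q \<in> face_prime F"
  proof (rule ccontr)
    assume notin: "\<not> (p \<in> face_prime F \<or> q \<in> face_prime F)"
    define A B where "A = {m \<in> Poly_Mapping.keys p. Poly_Mapping.keys m \<subseteq> F}"
      and "B = {m \<in> Poly_Mapping.keys q. Poly_Mapping.keys m \<subseteq> F}"
    have AB: "finite A" "A \<noteq> {}" "finite B" "B \<noteq> {}"
      using notin by (auto simp: A_def B_def face_prime_def)
    obtain g :: "('v \<Rightarrow>\<^sub>0 nat) \<Rightarrow> (nat \<Rightarrow>\<^sub>0 nat)" where g: "inj g" "\<And>m n. g (m + n) = g m + g n"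
      using exists_monomial_order by blast
    have "Max (g ` A) \<in> g ` A" "Max (g ` B) \<in> g ` B" using AB by (auto intro!: Max_in)
    then obtain a b where ab: "a \<in> A" "g a = Max (g ` A)" "b \<in> B" "g b = Max (g ` B)" by force
    have max: "g m \<le> g a" "g n \<le> g b" if "m \<in> A" "n \<in> B" for m n
      using that AB ab by auto
    have uniq: "m = a \<and> n = b"
      if "m \<in> Poly_Mapping.keys p" "n \<in> Poly_Mapping.keys q" "m + n = a + b" for m n
    proof -
      have "Poly_Mapping.keys (m + n) \<subseteq> F"
        using ab(1,3) unfolding that(3) by (simp add: A_def B_def keys_add_nat)
      then have "Poly_Mapping.keys m \<union> Poly_Mapping.keys n \<subseteq> F" by (simp add: keys_add_nat)
      then have le: "g m \<le> g a" "g n \<le> g b" using that by (auto intro!: max simp: A_def B_def)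
      have "g m + g n = g a + g b" using that(3) g(2) by metis
      then have "g m = g a" "g n = g b"
        using le add_less_le_mono[of "g m" "g a" "g n" "g b"] add_le_less_mono[of "g m" "g a" "g n" "g b"]
        by (metis order.order_iff_strict order.irrefl)+
      then show ?thesis using g(1) by (simp add: inj_eq)
    qed
    have "Poly_Mapping.lookup (p * q) (a + b) =
        (\<Sum>(m, n) \<in> Poly_Mapping.keys p \<times> Poly_Mapping.keys q.
          if (m, n) = (a, b) then Poly_Mapping.lookup p a * Poly_Mapping.lookup q b else 0)"
      unfolding lookup_mult_sum using uniq by (intro sum.cong) auto
    also have "\<dots> = (\<Sum>x \<in> Poly_Mapping.keys p \<times> Poly_Mapping.keys q.
          if x = (a, b) then Poly_Mapping.lookup p a * Poly_Mapping.lookup q b else 0)"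
      by (intro sum.cong) (auto split: if_splits)
    also have "\<dots> = Poly_Mapping.lookup p a * Poly_Mapping.lookup q b"
      using ab(1,3) by (simp add: A_def B_def)
    also have "\<dots> \<noteq> 0" using ab(1,3) by (simp add: A_def B_def in_keys_iff)
    finally have "a + b \<in> Poly_Mapping.keys (p * q)" by (simp add: in_keys_iff)
    moreover have "Poly_Mapping.keys (a + b) \<subseteq> F"
      using ab(1,3) by (simp add: A_def B_def keys_add_nat)
    ultimately show False using pq by (auto simp: face_prime_def)
  qed
qed

text \<open>The squarefree monomial of \<open>F\<close> lies in the ideal of
  \<open>\<Gamma>\<close>. Multiplied by a monomial supported in \<open>F\<close> it still has
  support \<open>F\<close>, a face of \<open>\<Delta>\<close>.\<close>

lemma annihilator_subset_face_prime:
  assumes "F \<in> \<Delta>" "F \<notin> \<Gamma>"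
  shows "annihilator (nonface_polynomials \<Gamma>) (nonface_polynomials \<Delta>) \<subseteq>
    (face_prime F :: ('v::finite, 'k::field) mpolynomial set)"
proof
  fix r :: "('v, 'k) mpolynomial"
  assume r: "r \<in> annihilator (nonface_polynomials \<Gamma>) (nonface_polynomials \<Delta>)"
  let ?x = "Poly_Mapping.single (squarefree_exponent F) 1 :: ('v, 'k) mpolynomial"
  have "?x \<in> nonface_polynomials \<Gamma>" using assms(2) by (simp add: nonface_polynomials_def)
  then have rx: "r * ?x \<in> nonface_polynomials \<Delta>" using r by (simp add: annihilator_def)
  show "r \<in> face_prime F"
    unfolding face_prime_def mem_Collect_eq
  proof (intro ballI notI)
    fix m assume m: "m \<in> Poly_Mapping.keys r" and "Poly_Mapping.keys m \<subseteq> F"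
    have "m + squarefree_exponent F \<in> Poly_Mapping.keys (r * ?x)"
      using m by (simp add: in_keys_iff lookup_mult_single)
    moreover have "Poly_Mapping.keys (m + squarefree_exponent F) = F"
      using \<open>Poly_Mapping.keys m \<subseteq> F\<close> by (auto simp: keys_add_nat)
    ultimately show False using rx assms(1) by (auto simp: nonface_polynomials_def)
  qed
qed

lemma face_prime_antimono: "G \<subseteq> F \<Longrightarrow> face_prime F \<subseteq> face_prime G"
  by (auto simp: face_prime_def)

text \<open>Dropping the vertices of \<open>F\<close> one by one gives a chain of primes over the
  annihilator. With the Cohen-Macaulay equation this bounds the depth from below.\<close>

lemma krull_dim_face_module_ge:
  fixes F :: "'v::finite set"
  assumes "F \<in> \<Delta>" "F \<notin> \<Gamma>"
  shows "enat (card F) \<le> krull_dim (nonface_polynomials \<Gamma>)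
    (nonface_polynomials \<Delta> :: ('v, 'k::field) mpolynomial set)"
proof -
  obtain xs where xs: "set xs = F" "distinct xs" using finite_distinct_list[of F] by auto
  define P where "P i = (face_prime (set (drop i xs)) :: ('v, 'k) mpolynomial set)" for i
  have len: "length xs = card F" using xs distinct_card by metis
  have "\<forall>i\<le>card F. prime_ideal (P i) \<and> annihilator (nonface_polynomials \<Gamma>) (nonface_polynomials \<Delta>) \<subseteq> P i"
  proof (intro allI impI conjI)
    fix i
    show "prime_ideal (P i)" unfolding P_def by (rule prime_ideal_face_prime)
    have "set (drop i xs) \<subseteq> F" using xs(1) set_drop_subset by fast
    then show "annihilator (nonface_polynomials \<Gamma>) (nonface_polynomials \<Delta>) \<subseteq> P i"
      unfolding P_def using annihilator_subset_face_prime[OF assms] face_prime_antimono by blast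
  qed
  moreover have "\<forall>i<card F. P i \<subset> P (Suc i)"
  proof (intro allI impI psubsetI)
    fix i assume i: "i < card F"
    have drop: "drop i xs = xs ! i # drop (Suc i) xs" using i len by (simp add: Cons_nth_drop_Suc)
    show "P i \<subseteq> P (Suc i)" unfolding P_def by (rule face_prime_antimono) (auto simp: drop)
    have "xs ! i \<notin> set (drop (Suc i) xs)"
      using distinct_drop[OF xs(2), of i] unfolding drop by simp
    then have "(variable (xs ! i) :: ('v, 'k) mpolynomial) \<in> P (Suc i)"
      "(variable (xs ! i) :: ('v, 'k) mpolynomial) \<notin> P i"
      unfolding P_def drop by (auto simp: face_prime_def variable_def)
    then show "P i \<noteq> P (Suc i)" by blast
  qed
  ultimately show ?thesis unfolding krull_dim_def by (intro Sup_upper) blast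
qed

section \<open>From Cohen-Macaulayness to acyclicity for linear parameters\<close>

lemma exists_regular_seq_of_depth:
  assumes "enat n \<le> depth \<mm> N L" "0 < n"
  shows "\<exists>as. set as \<subseteq> \<mm> \<and> regular_seq as N L \<and> n \<le> length as"
proof (rule ccontr)
  assume *: "\<not> ?thesis"
  \<comment> \<open>The supremum over an empty set is \<open>0\<close>, so it is
    \<open>0 < n\<close> that makes this bound a contradiction.\<close>
  have "depth \<mm> N L \<le> enat (n - 1)"
    unfolding depth_def
  proof (rule Sup_least)
    fix x assume "x \<in> {enat (length as) | as. set as \<subseteq> \<mm> \<and> regular_seq as N L}"
    then obtain as where as: "x = enat (length as)" "set as \<subseteq> \<mm>" "regular_seq as N L" by auto
    then have "length as < n" using * by (meson not_le)
    then show "x \<le> enat (n - 1)" using as(1) by simp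
  qed
  then have "enat n \<le> enat (n - 1)" using assms(1) order_trans by blast
  then show False using assms(2) by simp
qed

lemma rel_dimD:
  assumes "relative_complex \<Psi>" "rel_dim \<Psi> = int d - 1"
  shows "\<exists>F\<in>rel_faces \<Psi>. card F = d" and "F \<in> rel_faces \<Psi> \<Longrightarrow> card F \<le> d"
proof -
  let ?D = "(\<lambda>F. int (card F) - 1) ` rel_faces \<Psi>"
  have "rel_faces \<Psi> \<noteq> {}" using assms(1) by (auto simp: relative_complex_def rel_faces_def)
  then have "Max ?D \<in> ?D" by (intro Max_in) auto
  then show "\<exists>F\<in>rel_faces \<Psi>. card F = d" using assms(2) by (auto simp: rel_dim_def)
  show "card F \<le> d" if "F \<in> rel_faces \<Psi>"
  proof -
    have "int (card F) - 1 \<le> Max ?D" using that by (intro Max_ge) auto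
    then show ?thesis using assms(2) unfolding rel_dim_def by linarith
  qed
qed

lemma koszul_acyclic_parameters:
  fixes \<Psi> :: "'v::finite rel_cx" and \<theta>s :: "('v \<Rightarrow> 'k::field) list"
  assumes rc: "relative_complex \<Psi>" and dim: "rel_dim \<Psi> = int d - 1"
    and cm: "cohen_macaulay TYPE('k) \<Psi>"
    and sp: "\<And>F. F \<in> rel_faces \<Psi> \<Longrightarrow> spans_face \<theta>s F"
  shows "koszul_acyclic d (map linear_form \<theta>s)
    (nonface_polynomials (snd \<Psi>)) (nonface_polynomials (fst \<Psi>) :: ('v, 'k) mpolynomial set)"
proof -
  let ?N = "nonface_polynomials (snd \<Psi>) :: ('v, 'k) mpolynomial set"
  let ?L = "nonface_polynomials (fst \<Psi>) :: ('v, 'k) mpolynomial set"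
  have sc: "simplicial_complex (fst \<Psi>)" "simplicial_complex (snd \<Psi>)"
    using rc by (auto simp: relative_complex_def)
  have N: "ring_ideal ?N" and L: "ring_ideal ?L" using sc by (simp_all add: ring_ideal_nonface_polynomials)
  obtain vs :: "'v list" where vs: "set vs = UNIV" using finite_list[OF finite_class.finite_UNIV] by blast
  let ?vars = "map variable vs :: ('v, 'k) mpolynomial list"
  have "koszul_acyclic d ?vars ?N ?L"
  proof (cases "d = 0")
    case True
    then show ?thesis using koszul_acyclic_0[OF N L] by simp
  next
    case False
    obtain F where F: "F \<in> fst \<Psi>" "F \<notin> snd \<Psi>" "card F = d"
      using rel_dimD(1)[OF rc dim] by (auto simp: rel_faces_def)
    have "enat d \<le> depth irrelevant_ideal ?N ?L"
      using cm krull_dim_face_module_ge[OF F(1,2), where 'k = 'k] sc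
      by (simp add: cohen_macaulay_def Let_def stanley_reisner_ideal_eq F(3))
    then obtain as where as: "set as \<subseteq> irrelevant_ideal" "regular_seq as ?N ?L" "d \<le> length as"
      using exists_regular_seq_of_depth False by blast
    then have "koszul_acyclic (length as) ?vars ?N ?L"
      using vs by (intro koszul_acyclic_of_regular_seq N L) (simp_all add: irrelevant_ideal_def)
    then show ?thesis using as(3) by (rule koszul_acyclic_mono)
  qed
  \<comment> \<open>The variables stand last because \<open>koszul_acyclic_appendD\<close> removes
    entries from the end.\<close>
  then have "koszul_acyclic d (map linear_form \<theta>s @ ?vars) ?N ?L"
    by (rule koszul_acyclic_append[OF N L])
  then show ?thesis
  proof (rule koszul_acyclic_appendD[OF N L])
    fix b assume "b \<in> set ?vars"
    then obtain v where b: "b = variable v" by auto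
    let ?J = "ideal_gen (set (map linear_form \<theta>s) \<union> annihilator ?N ?L)"
    \<comment> \<open>The downward closure of the relative faces, rather than
      \<open>fst \<Psi>\<close>: the monomial of any other set annihilates the face module, and
      \<open>\<theta>s\<close> spans on all of its members.\<close>
    let ?\<Delta> = "{G. \<exists>F\<in>rel_faces \<Psi>. G \<subseteq> F}"
    note J = ring_ideal_ideal_gen
    have gen: "set (map linear_form \<theta>s) \<subseteq> ?J" "annihilator ?N ?L \<subseteq> ?J"
      using ideal_gen_superset[of "set (map linear_form \<theta>s) \<union> annihilator ?N ?L"] by auto
    have "(\<Prod>v\<in>{v}. variable v) \<in> ideal_radical ?J"
    proof (rule prod_variable_in_radical[where S = "fun_span \<theta>s" and \<Delta> = ?\<Delta> and J = ?J])
      show "ring_ideal ?J" by (rule J)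
      show "linear_form \<theta> \<in> ?J" if "\<theta> \<in> fun_span \<theta>s" for \<theta>
      proof (rule linear_form_fun_span[OF J _ that])
        show "linear_form \<theta>' \<in> ?J" if "\<theta>' \<in> set \<theta>s" for \<theta>'
          by (rule subsetD[OF gen(1)]) (simp add: that)
      qed
      show "\<exists>\<theta>\<in>fun_span \<theta>s. \<forall>v\<in>F. \<theta> v = (if v = w then 1 else 0)" if "F \<in> ?\<Delta>" "w \<in> F" for F w
      proof -
        have "spans_face \<theta>s F" using that(1) sp spans_face_subset by blast
        then show ?thesis using that(2) unfolding spans_face_def by blast
      qed
      show "(\<Prod>v\<in>G. variable v) \<in> ?J" if "G \<notin> ?\<Delta>" for G
      proof (rule subsetD[OF gen(2)], rule nonface_monomial_annihilates[OF sc(2,1)])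
        show "\<nexists>F. F \<in> fst \<Psi> - snd \<Psi> \<and> G \<subseteq> F" using that by (auto simp: rel_faces_def)
      qed
      show "{v} \<noteq> {}" by simp
    qed
    then show "\<exists>p. b ^ p \<in> ?J" by (simp add: ideal_radical_def b)
  qed
qed

section \<open>The h-vector as a Hilbert function\<close>

definition num_monomials :: "'v::finite set \<Rightarrow> nat \<Rightarrow> nat" where
  "num_monomials F e = card {m :: 'v \<Rightarrow>\<^sub>0 nat. Poly_Mapping.keys m = F \<and> total_degree m = e}"

lemma finite_total_degree_Collect: "finite {m :: 'v::finite \<Rightarrow>\<^sub>0 nat. P m \<and> total_degree m = e}"
  by (rule finite_subset[OF _ finite_total_degree_eq[of e]]) auto

lemma total_degree_eq_0_iff: "total_degree m = 0 \<longleftrightarrow> m = 0"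
  unfolding poly_mapping_eq_iff fun_eq_iff by (auto simp: total_degree_def)

text \<open>Dividing by the variable \<open>v\<close> either keeps \<open>v\<close> in the support
  or removes it.\<close>

lemma num_monomials_insert_Suc:
  assumes "v \<notin> F"
  shows "num_monomials (insert v F) (Suc e) = num_monomials (insert v F) e + num_monomials F e"
proof -
  let ?A = "\<lambda>F e. {m :: 'a \<Rightarrow>\<^sub>0 nat. Poly_Mapping.keys m = F \<and> total_degree m = e}"
  let ?f = "\<lambda>m. m + Poly_Mapping.single v 1"
  have f: "Poly_Mapping.keys (?f m) = insert v (Poly_Mapping.keys m)"
    "total_degree (?f m) = Suc (total_degree m)" for m
    by (simp_all add: keys_add_nat total_degree_add)
  have "?A (insert v F) (Suc e) = ?f ` (?A (insert v F) e \<union> ?A F e)"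
  proof
    show "?f ` (?A (insert v F) e \<union> ?A F e) \<subseteq> ?A (insert v F) (Suc e)"
      using f by auto
    show "?A (insert v F) (Suc e) \<subseteq> ?f ` (?A (insert v F) e \<union> ?A F e)"
    proof
      fix m assume m: "m \<in> ?A (insert v F) (Suc e)"
      define m' where "m' = m - Poly_Mapping.single v 1"
      have "Poly_Mapping.lookup m v \<noteq> 0" using m by (metis (mono_tags) in_keys_iff insertI1 mem_Collect_eq)
      then have mm': "m = ?f m'"
        unfolding m'_def by (intro poly_mapping_eqI) (auto simp: lookup_add lookup_minus lookup_single when_def)
      then have "insert v F = insert v (Poly_Mapping.keys m')" "total_degree m' = e"
        using m f[of m'] by simp_all
      then have "m' \<in> ?A (insert v F) e \<union> ?A F e"
        using assms by (cases "v \<in> Poly_Mapping.keys m'") auto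
      then show "m \<in> ?f ` (?A (insert v F) e \<union> ?A F e)" using mm' by blast
    qed
  qed
  moreover have "inj_on ?f (?A (insert v F) e \<union> ?A F e)" by (auto intro: inj_onI)
  moreover have "?A (insert v F) e \<inter> ?A F e = {}" using assms by auto
  ultimately show ?thesis
    unfolding num_monomials_def
    by (simp add: card_image card_Un_disjoint finite_total_degree_Collect)
qed

text \<open>The generating function is the power \<open>card F\<close> of
  \<open>t / (1 - t)\<close>, stated here with denominators cleared.\<close>

lemma fps_num_monomials:
  "(1 - fps_X) ^ card F * Abs_fps (\<lambda>e. int (num_monomials F e)) = fps_X ^ card F"
  using finite[of F]
proof (induction F rule: finite_induct)
  case empty
  have "{m :: 'a \<Rightarrow>\<^sub>0 nat. Poly_Mapping.keys m = {} \<and> total_degree m = e} = (if e = 0 then {0} else {})" for e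
    using total_degree_eq_0_iff by (auto simp: total_degree_def)
  then have "Abs_fps (\<lambda>e. int (num_monomials ({} :: 'a set) e)) = 1"
    by (intro fps_ext) (simp add: num_monomials_def)
  then show ?case by simp
next
  case (insert v F)
  let ?S = "\<lambda>F. Abs_fps (\<lambda>e. int (num_monomials F e))"
  have "num_monomials (insert v F) 0 = 0"
    by (auto simp: num_monomials_def total_degree_eq_0_iff)
  then have "(1 - fps_X) * ?S (insert v F) = fps_X * ?S F"
    by (intro fps_ext)
      (auto simp: left_diff_distrib gr0_conv_Suc num_monomials_insert_Suc[OF insert.hyps(2)] dest!: not0_implies_Suc)
  then have "(1 - fps_X) ^ card (insert v F) * ?S (insert v F) =
      fps_X * ((1 - fps_X) ^ card F * ?S F)"
    using insert.hyps by (simp add: mult.assoc mult.left_commute)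
  then show ?case using insert by simp
qed

text \<open>The monomials in the ideal of the smaller complex but not in that of the larger one are
  those whose support is a relative face.\<close>

lemma hilbert_face_module:
  fixes \<Psi> :: "'v::finite rel_cx"
  assumes "relative_complex \<Psi>"
  shows "hilbert (nonface_polynomials (snd \<Psi>)) (nonface_polynomials (fst \<Psi>) :: ('v, 'k::field) mpolynomial set) e =
    (\<Sum>F\<in>rel_faces \<Psi>. int (num_monomials F e))"
proof -
  let ?A = "\<lambda>P. {m :: 'v \<Rightarrow>\<^sub>0 nat. P (Poly_Mapping.keys m) \<and> total_degree m = e}"
  have "?A (\<lambda>F. F \<notin> snd \<Psi>) = ?A (\<lambda>F. F \<notin> fst \<Psi>) \<union> (\<Union>F\<in>rel_faces \<Psi>. ?A (\<lambda>G. G = F))"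
    using assms by (auto simp: relative_complex_def rel_faces_def)
  moreover have "?A (\<lambda>F. F \<notin> fst \<Psi>) \<inter> (\<Union>F\<in>rel_faces \<Psi>. ?A (\<lambda>G. G = F)) = {}"
    by (auto simp: rel_faces_def)
  moreover have "card (\<Union>F\<in>rel_faces \<Psi>. ?A (\<lambda>G. G = F)) = (\<Sum>F\<in>rel_faces \<Psi>. num_monomials F e)"
    unfolding num_monomials_def
    by (rule card_UN_disjoint) (auto simp: finite_total_degree_Collect)
  ultimately have "card (?A (\<lambda>F. F \<notin> snd \<Psi>)) =
      card (?A (\<lambda>F. F \<notin> fst \<Psi>)) + (\<Sum>F\<in>rel_faces \<Psi>. num_monomials F e)"
    by (simp add: card_Un_disjoint finite_total_degree_Collect)
  then show ?thesis
    unfolding hilbert_def nonface_polynomials_def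
      dim_degree_part[of e "\<lambda>m. Poly_Mapping.keys m \<notin> _"] by simp
qed

text \<open>Grouping the faces by cardinality turns the Hilbert series into the defining sum of the
  h-polynomial. The bound on \<open>card F\<close> keeps \<open>d - card F\<close> from
  truncating.\<close>

lemma fps_of_h_poly:
  fixes \<Psi> :: "'v::finite rel_cx"
  assumes rc: "relative_complex \<Psi>" and "\<And>F. F \<in> rel_faces \<Psi> \<Longrightarrow> card F \<le> d"
  shows "fps_of_poly (h_poly d \<Psi>) = (1 - fps_X) ^ d * Abs_fps (hilbert (nonface_polynomials (snd \<Psi>))
    (nonface_polynomials (fst \<Psi>) :: ('v, 'k::field) mpolynomial set))"
proof -
  let ?S = "\<lambda>F. Abs_fps (\<lambda>e. int (num_monomials F e))"
  have lin: "fps_of_poly [:1, -1:] = (1 - fps_X :: int fps)" "fps_of_poly [:0, 1:] = (fps_X :: int fps)"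
    by (rule fps_ext; simp add: coeff_pCons split: nat.split)+
  have nat: "fps_of_poly (of_nat n) = (of_nat n :: int fps)" for n
    by (induction n) (simp_all add: fps_of_poly_add)
  have "Abs_fps (hilbert (nonface_polynomials (snd \<Psi>))
      (nonface_polynomials (fst \<Psi>) :: ('v, 'k) mpolynomial set)) = (\<Sum>F\<in>rel_faces \<Psi>. ?S F)"
    by (rule fps_ext) (simp add: hilbert_face_module[OF rc] fps_sum_nth)
  also have "(1 - fps_X) ^ d * (\<Sum>F\<in>rel_faces \<Psi>. ?S F) =
      (\<Sum>F\<in>rel_faces \<Psi>. fps_X ^ card F * (1 - fps_X) ^ (d - card F))"
    unfolding sum_distrib_left
  proof (rule sum.cong[OF refl])
    fix F assume "F \<in> rel_faces \<Psi>"
    then have "(1 - fps_X :: int fps) ^ d = (1 - fps_X) ^ (d - card F) * (1 - fps_X) ^ card F"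
      using assms(2) by (simp flip: power_add)
    then have "(1 - fps_X) ^ d * ?S F = (1 - fps_X) ^ (d - card F) * ((1 - fps_X) ^ card F * ?S F)"
      by (simp only: mult.assoc)
    then show "(1 - fps_X) ^ d * ?S F = fps_X ^ card F * (1 - fps_X) ^ (d - card F)"
      by (simp only: fps_num_monomials) (rule mult.commute)
  qed
  also have "\<dots> = (\<Sum>k=0..d. \<Sum>F | F \<in> rel_faces \<Psi> \<and> card F = k. fps_X ^ card F * (1 - fps_X) ^ (d - card F))"
    using assms(2) by (intro sum.group[symmetric]) auto
  also have "\<dots> = (\<Sum>k=0..d. of_nat (f_num \<Psi> (int k - 1)) * fps_X ^ k * (1 - fps_X) ^ (d - k))"
    by (intro sum.cong) (simp_all add: f_num_def mult.assoc)
  also have "\<dots> = fps_of_poly (h_poly d \<Psi>)"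
    by (simp add: h_poly_def fps_of_poly_sum fps_of_poly_mult fps_of_poly_power lin nat)
  finally show ?thesis by simp
qed

text \<open>Cohen-Macaulayness makes the \<open>d\<close> parameters a regular sequence, so
  adjoining them multiplies the Hilbert series by exactly the factor that yields the
  h-polynomial.\<close>

lemma coeff_h_poly_eq_hilbert:
  fixes \<Psi> :: "'v::finite rel_cx" and \<theta>s :: "('v \<Rightarrow> 'k::field) list"
  assumes rc: "relative_complex \<Psi>" and dim: "rel_dim \<Psi> = int d - 1"
    and cm: "cohen_macaulay TYPE('k) \<Psi>" and len: "length \<theta>s = d"
    and sp: "\<And>F. F \<in> rel_faces \<Psi> \<Longrightarrow> spans_face \<theta>s F"
  shows "coeff (h_poly d \<Psi>) n = hilbert (nonface_polynomials (snd \<Psi>))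
    (adjoin (map linear_form \<theta>s) (nonface_polynomials (snd \<Psi>)) (nonface_polynomials (fst \<Psi>))) n"
proof -
  let ?N = "nonface_polynomials (snd \<Psi>) :: ('v, 'k) mpolynomial set"
  let ?L = "nonface_polynomials (fst \<Psi>) :: ('v, 'k) mpolynomial set"
  have "Abs_fps (hilbert ?N (adjoin (map linear_form \<theta>s) ?N ?L)) =
      (1 - fps_X) ^ length (map linear_form \<theta>s) * Abs_fps (hilbert ?N ?L)"
  proof (rule hilbert_adjoin)
    show "ring_ideal ?N" "ring_ideal ?L" "?L \<subseteq> ?N"
      using rc by (auto simp: relative_complex_def ring_ideal_nonface_polynomials
          intro: nonface_polynomials_mono[THEN subsetD])
    show "koszul_acyclic (length (map linear_form \<theta>s)) (map linear_form \<theta>s) ?N ?L"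
      using koszul_acyclic_parameters[OF rc dim cm sp] len by simp
    show "polynomial.linear_element a" if "a \<in> set (map linear_form \<theta>s)" for a :: "('v, 'k) mpolynomial"
      using that linear_element_linear_form by auto
  qed (rule homogeneous_nonface_polynomials)+
  also have "\<dots> = fps_of_poly (h_poly d \<Psi>)"
    using fps_of_h_poly[OF rc rel_dimD(2)[OF rc dim], where 'k = 'k] len by simp
  finally show ?thesis by (metis Abs_fps_inverse UNIV_I fps_nth_Abs_fps fps_of_poly_nth)
qed

section \<open>Comparison of the h-vectors of the complex and its subcomplex\<close>

lemma h_poly_Suc:
  assumes "\<And>F. F \<in> rel_faces \<Psi> \<Longrightarrow> card F \<le> d"
  shows "h_poly (Suc d) \<Psi> = [:1, -1:] * h_poly d \<Psi>"
proof -
  have "f_num \<Psi> (int (Suc d) - 1) = 0"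
    using assms by (fastforce simp: f_num_def card_eq_0_iff)
  then have "h_poly (Suc d) \<Psi> =
      (\<Sum>k=0..d. of_nat (f_num \<Psi> (int k - 1)) * [:0, 1:] ^ k * [:1, -1:] ^ (Suc d - k))"
    by (simp add: h_poly_def)
  also have "\<dots> = [:1, -1:] * h_poly d \<Psi>"
    unfolding h_poly_def sum_distrib_left
  proof (rule sum.cong[OF refl])
    fix k assume "k \<in> {0..d}"
    then have "Suc d - k = Suc (d - k)" by auto
    then show "of_nat (f_num \<Psi> (int k - 1)) * [:0, 1:] ^ k * [:1, -1:] ^ (Suc d - k) =
        [:1, -1:] * (of_nat (f_num \<Psi> (int k - 1)) * [:0, 1:] ^ k * [:1, -1:] ^ (d - k))"
      by (simp only: power_Suc mult.left_commute)
  qed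
  finally show ?thesis .
qed

lemma h_poly_rel_pair:
  assumes "relative_subcomplex \<Psi>' \<Psi>" "rel_faces \<Psi>' \<subseteq> rel_faces \<Psi>"
  shows "h_poly d \<Psi> = h_poly d (rel_pair \<Psi> \<Psi>') + h_poly d \<Psi>'"
proof -
  have "f_num \<Psi> i = f_num (rel_pair \<Psi> \<Psi>') i + f_num \<Psi>' i" for i
  proof -
    let ?A = "\<lambda>\<Phi>. {F \<in> rel_faces \<Phi>. int (card F) - 1 = i}"
    have "?A \<Psi> = ?A (rel_pair \<Psi> \<Psi>') \<union> ?A \<Psi>'" "?A (rel_pair \<Psi> \<Psi>') \<inter> ?A \<Psi>' = {}"
      using assms by (auto simp: relative_subcomplex_def rel_faces_def rel_pair_def)
    then show ?thesis unfolding f_num_def by (simp add: card_Un_disjoint)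
  qed
  then show ?thesis by (simp add: h_poly_def sum.distrib distrib_right)
qed

text \<open>Surjectivity of the map between face modules. By \<open>faces\<close>, a monomial of
  \<open>p\<close> whose support lies in \<open>snd \<Psi>\<close> cannot have it in
  \<open>fst \<Psi>'\<close>, so it is already zero modulo \<open>Q\<close>.\<close>

lemma nonface_polynomials_subcomplex:
  fixes Q :: "('v::finite, 'k::field) mpolynomial set"
  assumes sub: "relative_subcomplex \<Psi>' \<Psi>" and faces: "rel_faces \<Psi>' \<subseteq> rel_faces \<Psi>"
    and Q: "ring_ideal Q" "nonface_polynomials (fst \<Psi>') \<subseteq> Q" "Q \<subseteq> nonface_polynomials (snd \<Psi>')"
  shows "nonface_polynomials (snd \<Psi>') = {q + x | q x. q \<in> Q \<and> x \<in> nonface_polynomials (snd \<Psi>)}"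
proof
  have "simplicial_complex (snd \<Psi>')" "snd \<Psi>' \<subseteq> snd \<Psi>"
    using sub by (auto simp: relative_subcomplex_def relative_complex_def)
  then have "ring_ideal (nonface_polynomials (snd \<Psi>') :: ('v, 'k) mpolynomial set)"
    "nonface_polynomials (snd \<Psi>) \<subseteq> (nonface_polynomials (snd \<Psi>') :: ('v, 'k) mpolynomial set)"
    by (simp_all add: ring_ideal_nonface_polynomials nonface_polynomials_mono)
  then show "{q + x | q x. q \<in> Q \<and> x \<in> nonface_polynomials (snd \<Psi>)} \<subseteq> nonface_polynomials (snd \<Psi>')"
    using Q(3) by (auto intro: ideal_add)
  show "nonface_polynomials (snd \<Psi>') \<subseteq> {q + x | q x. q \<in> Q \<and> x \<in> nonface_polynomials (snd \<Psi>)}"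
  proof
    fix p :: "('v, 'k) mpolynomial" assume p: "p \<in> nonface_polynomials (snd \<Psi>')"
    define x where "x = Poly_Mapping.mapp (\<lambda>m c. if Poly_Mapping.keys m \<in> snd \<Psi> then 0 else c) p"
    have lx: "Poly_Mapping.lookup x m = (if Poly_Mapping.keys m \<in> snd \<Psi> then 0 else Poly_Mapping.lookup p m)" for m
      by (auto simp: x_def lookup_mapp when_def in_keys_iff)
    have "x \<in> nonface_polynomials (snd \<Psi>)"
      by (auto simp: nonface_polynomials_def in_keys_iff lx)
    moreover have "p - x \<in> nonface_polynomials (fst \<Psi>')"
      unfolding nonface_polynomials_def mem_Collect_eq
    proof (intro ballI notI)
      fix m assume m: "m \<in> Poly_Mapping.keys (p - x)" "Poly_Mapping.keys m \<in> fst \<Psi>'"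
      then have "Poly_Mapping.keys m \<in> snd \<Psi>" "m \<in> Poly_Mapping.keys p"
        by (auto simp: in_keys_iff lookup_minus lx split: if_splits)
      then show False using p m(2) faces by (auto simp: nonface_polynomials_def rel_faces_def)
    qed
    ultimately have "p - x \<in> Q \<and> x \<in> nonface_polynomials (snd \<Psi>)" using Q(2) by blast
    moreover have "p = (p - x) + x" by simp
    ultimately show "p \<in> {q + x | q x. q \<in> Q \<and> x \<in> nonface_polynomials (snd \<Psi>)}" by blast
  qed
qed

lemma adjoin_mono:
  assumes "N \<subseteq> N'" "L \<subseteq> L'"
  shows "adjoin as N L \<subseteq> adjoin as N' L'"
proof (induction as)
  case (Cons a as)
  then show ?case unfolding adjoin.simps using assms(1) by blast
qed (simp add: assms(2))

text \<open>Here \<open>d\<close> is the number of parameters for \<open>\<Psi>'\<close>, one less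
  than in the final theorem.\<close>

lemma h_poly_coeff_le_of_full_subcomplex:
  fixes \<Psi> \<Psi>' :: "'v::finite rel_cx"
  assumes inf: "infinite (UNIV :: 'k::field set)"
    and rc: "relative_complex \<Psi>" and dim: "rel_dim \<Psi> = int (Suc d) - 1"
    and cm: "cohen_macaulay TYPE('k) \<Psi>"
    and sub: "relative_subcomplex \<Psi>' \<Psi>" and faces: "rel_faces \<Psi>' \<subseteq> rel_faces \<Psi>"
    and full: "full_in \<Psi>' \<Psi>" and dim': "rel_dim \<Psi>' = int d - 1"
    and cm': "cohen_macaulay TYPE('k) \<Psi>'"
  shows "coeff (h_poly d \<Psi>') n \<le> coeff (h_poly (Suc d) \<Psi>) n"
proof -
  have rc': "relative_complex \<Psi>'" using sub by (simp add: relative_subcomplex_def)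
  let ?N = "nonface_polynomials (snd \<Psi>) :: ('v, 'k) mpolynomial set"
  let ?L = "nonface_polynomials (fst \<Psi>) :: ('v, 'k) mpolynomial set"
  let ?N' = "nonface_polynomials (snd \<Psi>') :: ('v, 'k) mpolynomial set"
  let ?L' = "nonface_polynomials (fst \<Psi>') :: ('v, 'k) mpolynomial set"
  have incl: "?N \<subseteq> ?N'" "?L \<subseteq> ?L'" "?L \<subseteq> ?N" "?L' \<subseteq> ?N'"
    using sub rc by (auto simp: relative_subcomplex_def relative_complex_def nonface_polynomials_def)
  have I: "ring_ideal ?N" "ring_ideal ?L" "ring_ideal ?N'" "ring_ideal ?L'"
    using rc rc' by (simp_all add: relative_complex_def ring_ideal_nonface_polynomials)
  define W where "W = {v. {v} \<notin> fst \<Psi>'}"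
  obtain \<theta>s :: "('v \<Rightarrow> 'k) list" where \<theta>s: "length \<theta>s = d" "\<And>F. card F \<le> d \<Longrightarrow> spans_face \<theta>s F"
    using exists_spanning_forms[OF inf] by blast
  have "\<exists>u. u \<in> F \<and> u \<in> W \<and> spans_face \<theta>s (F - {u})" if F: "F \<in> {F \<in> rel_faces \<Psi>. card F = Suc d}" for F
  proof -
    \<comment> \<open>By fullness, a largest face of \<open>\<Psi>\<close> on vertices of
      \<open>\<Psi>'\<close> would be a relative face of \<open>\<Psi>'\<close>, where it is too
      large. So \<open>F\<close> has a vertex in \<open>W\<close>.\<close>
    have "\<not> F \<subseteq> \<Union>(fst \<Psi>')"
    proof
      assume "F \<subseteq> \<Union>(fst \<Psi>')"
      then have "F \<in> fst \<Psi>'" using full F by (auto simp: full_in_def rel_faces_def)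
      then have "F \<in> rel_faces \<Psi>'" using F sub by (auto simp: rel_faces_def relative_subcomplex_def)
      then have "card F \<le> d" by (rule rel_dimD(2)[OF rc' dim'])
      then show False using F by simp
    qed
    then obtain u where "u \<in> F" "u \<in> W" unfolding W_def by blast
    then show ?thesis using F \<theta>s(2)[of "F - {u}"] by auto
  qed
  then have "\<exists>s. (\<forall>v. v \<notin> W \<longrightarrow> s v = 0) \<and>
      (\<forall>F\<in>{F \<in> rel_faces \<Psi>. card F = Suc d}. spans_face (s # \<theta>s) F)"
    by (rule exists_spanning_extension[OF inf])
  then obtain s where s: "\<And>v. v \<notin> W \<Longrightarrow> s v = 0"
    "\<And>F. F \<in> rel_faces \<Psi> \<Longrightarrow> card F = Suc d \<Longrightarrow> spans_face (s # \<theta>s) F"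
    by auto
  have sp: "spans_face (s # \<theta>s) F" if F: "F \<in> rel_faces \<Psi>" for F
  proof (cases "card F = Suc d")
    case False
    then have "card F \<le> d" using rel_dimD(2)[OF rc dim F] by simp
    then show ?thesis by (intro spans_face_Cons \<theta>s)
  qed (use F s in simp)
  have sp': "spans_face \<theta>s F" if F: "F \<in> rel_faces \<Psi>'" for F
    by (intro \<theta>s(2) rel_dimD(2)[OF rc' dim' F])
  define P where "P = adjoin (map linear_form (s # \<theta>s)) ?N ?L"
  define Q where "Q = adjoin (map linear_form \<theta>s) ?N' ?L'"
  have Q: "ring_ideal Q" "?L' \<subseteq> Q" "Q \<subseteq> ?N'" "polynomial.homogeneous Q"
    unfolding Q_def
    by (rule ring_ideal_adjoin[OF I(3,4)] adjoin_superset[OF ideal_zero[OF I(3)]]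
        adjoin_subset[OF I(3) incl(4)])+
       (rule polynomial.homogeneous_adjoin[OF I(3,4)];
        auto simp: homogeneous_nonface_polynomials linear_element_linear_form)
  \<comment> \<open>The form \<open>s\<close> uses only variables that vanish on the face module of
    \<open>\<Psi>'\<close>, so adjoining it costs nothing there and
    \<open>P \<subseteq> Q\<close>.\<close>
  have "variable v \<in> ?L'" if "v \<in> W" for v
    using that by (simp add: W_def variable_def nonface_polynomials_def)
  then have "const (s v) * variable v \<in> ?L'" for v
    using s(1)[of v] ideal_mult[OF I(4)] ideal_zero[OF I(4)] by (cases "v \<in> W") auto
  then have "linear_form s \<in> ?L'"
    unfolding linear_form_def by (intro ideal_sum[OF I(4)])
  then have "linear_form s * x \<in> Q" for x
    using ideal_mult_right[OF I(4)] Q(2) by blast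
  moreover have "adjoin (map linear_form \<theta>s) ?N ?L \<subseteq> Q"
    unfolding Q_def by (rule adjoin_mono[OF incl(1,2)])
  ultimately have "P \<subseteq> Q" unfolding P_def by (auto intro!: ideal_add[OF Q(1)])
  moreover have "P \<subseteq> ?N" unfolding P_def by (rule adjoin_subset[OF I(1) incl(3)])
  ultimately have "hilbert ?N' Q n \<le> hilbert ?N P n"
    by (intro hilbert_mono[OF I(1) homogeneous_nonface_polynomials Q(1,4)]
        nonface_polynomials_subcomplex[OF sub faces Q(1-3)]) blast
  moreover have "coeff (h_poly d \<Psi>') n = hilbert ?N' Q n"
    unfolding Q_def by (rule coeff_h_poly_eq_hilbert[OF rc' dim' cm' \<theta>s(1) sp'])
  moreover have "coeff (h_poly (Suc d) \<Psi>) n = hilbert ?N P n"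
    unfolding P_def by (rule coeff_h_poly_eq_hilbert[OF rc dim cm _ sp]) (simp add: \<theta>s(1))
  ultimately show ?thesis by simp
qed

theorem theorem4p24:
  fixes \<Psi> \<Psi>' :: "'v::finite rel_cx" and d :: nat and k :: int
  assumes "infinite (UNIV :: 'k::field set)"
    and "relative_complex \<Psi>"
    and "rel_dim \<Psi> = int d - 1"
    and "cohen_macaulay TYPE('k) \<Psi>"
    and "relative_subcomplex \<Psi>' \<Psi>"
    and "rel_faces \<Psi>' \<subseteq> rel_faces \<Psi>"
    and "full_in \<Psi>' \<Psi>"
    and "rel_dim \<Psi>' = int d - 2"
    and "cohen_macaulay TYPE('k) \<Psi>'"
  shows "h_vec d (rel_pair \<Psi> \<Psi>') k \<ge> h_vec (d - 1) \<Psi>' (k - 1)"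
proof -
  have rc': "relative_complex \<Psi>'" using assms(5) by (simp add: relative_subcomplex_def)
  obtain F where F: "F \<in> rel_faces \<Psi>'"
    using rc' by (auto simp: relative_complex_def rel_faces_def)
  \<comment> \<open>A dimension is at least \<open>-1\<close>, so \<open>d\<close> is positive and
    \<open>d - 1\<close> does not truncate.\<close>
  have "int (card F) - 1 \<le> rel_dim \<Psi>'"
    unfolding rel_dim_def using F by (intro Max_ge) auto
  then obtain e where d: "d = Suc e" using assms(8) by (cases d) auto
  have dim': "rel_dim \<Psi>' = int e - 1" using assms(8) by (simp add: d)
  show ?thesis
  proof (cases "k < 0")
    case False
    define n where "n = nat k"
    have le: "coeff (h_poly e \<Psi>') n \<le> coeff (h_poly d \<Psi>) n"
      unfolding d using assms(1-7,9) dim'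
      by (intro h_poly_coeff_le_of_full_subcomplex[where 'k = 'k]) (simp_all add: d)
    \<comment> \<open>Additivity over faces holds for one common degree, so \<open>\<Psi>'\<close>
      is first lifted from \<open>e\<close> to \<open>d\<close>; the factor \<open>[:1, -1:]\<close>
      produces the shifted entry of index \<open>k - 1\<close>.\<close>
    have "h_poly d (rel_pair \<Psi> \<Psi>') = h_poly d \<Psi> - [:1, -1:] * h_poly e \<Psi>'"
      using h_poly_rel_pair[OF assms(5,6), of d] h_poly_Suc[OF rel_dimD(2)[OF rc' dim']]
      by (simp add: d)
    then have "coeff (h_poly d (rel_pair \<Psi> \<Psi>')) n =
        coeff (h_poly d \<Psi>) n - coeff (h_poly e \<Psi>') n + (if n = 0 then 0 else coeff (h_poly e \<Psi>') (n - 1))"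
      by (cases n) simp_all
    moreover have "h_vec e \<Psi>' (k - 1) = (if n = 0 then 0 else coeff (h_poly e \<Psi>') (n - 1))"
      using False by (auto simp: h_vec_def n_def nat_diff_distrib)
    ultimately show ?thesis using le False by (simp add: h_vec_def d n_def)
  qed (simp add: h_vec_def)
qed

end
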